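(* If the entire function $f\in\mathcal{K}$ has finite order and has one Borel exceptional value, then $f$ is a clan.
   Context: $\mathcal{K}$ is the class of nonconstant power series $f(z)=\sum_{n=0}^\infty a_nz^n$ with positive radius of convergence $R\le\infty$, with all $a_n\ge 0$ and with $a_0>0$; $f$ entire means $R=\infty$. The associated (Khinchin) family $(X_t)_{t\ge 0}$ of an entire $f\in\mathcal{K}$ consists of random variables with values in $\{0,1,2,\dots\}$, with $X_0\equiv 0$ and $\mathbf{P}(X_t=n)=a_nt^n/f(t)$ for $t>0$, $n\ge 0$. Write $m_f(t)=\mathbf{E}(X_t)=tf'(t)/f(t)$ and $\sigma_f^2(t)=\mathbf{V}(X_t)=t\,m_f'(t)$, with $\sigma_f(t)\ge0$. An entire $f\in\mathcal{K}$ is a clan if $\lim_{t\to\infty}\sigma_f(t)/m_f(t)=0$. The order of $f$ is $\rho(f)=\limsup_{t\to\infty}\frac{\ln\ln f(t)}{\ln t}$ (note $\max_{|z|=t}|f(z)|=f(t)$). A number $a\in\mathbb{C}$ is a Borel exceptional value of an entire function $f$ of finite order if the exponent of convergence of the zeros of $f(z)-a$ is strictly smaller than the order of $f$. *)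

theory Defs
  imports "HOL-Complex_Analysis.Complex_Analysis" "HOL-Probability.Probability"
begin

definition class_K :: "real fps set" where
  "class_K = {f. fps_conv_radius f > 0 \<and> (\<forall>n. fps_nth f n \<ge> 0) \<and> fps_nth f 0 > 0 \<and>
                 (\<exists>n>0. fps_nth f n \<noteq> 0)}"

definition entire_fps :: "real fps \<Rightarrow> bool" where
  "entire_fps f \<longleftrightarrow> fps_conv_radius f = \<infinity>"

text \<open>The holomorphic function with the real Taylor coefficients of \<open>f\<close>.\<close>
definition eval_complex :: "real fps \<Rightarrow> complex \<Rightarrow> complex" where
  "eval_complex f z = eval_fps (Abs_fps (\<lambda>n. of_real (fps_nth f n))) z"

text \<open>
  The law of \<open>X\<^sub>t\<close>. At \<open>t = 0\<close> the weights are those of the point mass at \<open>0\<close>, since \<open>0 ^ 0 = 1\<close>.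
  The weights form a probability mass function for \<open>f \<in> class_K\<close> and \<open>t\<close> nonnegative and below
  the radius of convergence (see \<open>pmf_khinchin\<close> below); for other arguments the value
  is unspecified.
\<close>
definition khinchin :: "real fps \<Rightarrow> real \<Rightarrow> nat pmf" where
  "khinchin f t = embed_pmf (\<lambda>n. fps_nth f n * t ^ n / eval_fps f t)"

definition khinchin_mean :: "real fps \<Rightarrow> real \<Rightarrow> real" where
  "khinchin_mean f t = measure_pmf.expectation (khinchin f t) real"

definition khinchin_sd :: "real fps \<Rightarrow> real \<Rightarrow> real" where
  "khinchin_sd f t = sqrt (measure_pmf.variance (khinchin f t) real)"

definition clan :: "real fps \<Rightarrow> bool" where
  "clan f \<longleftrightarrow> f \<in> class_K \<and> entire_fps f \<and>
     ((\<lambda>t. khinchin_sd f t / khinchin_mean f t) \<longlongrightarrow> 0) at_top"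

text \<open>
  For \<open>f \<in> class_K\<close> the coefficients are nonnegative, so the maximum modulus on the circle of
  radius \<open>t\<close> is the value at \<open>t\<close>.
\<close>
definition growth_order :: "real fps \<Rightarrow> ereal" where
  "growth_order f = Limsup at_top (\<lambda>t. ereal (ln (ln (eval_fps f t)) / ln t))"

text \<open>
  Zeros are counted with multiplicity, and a zero at the origin is disregarded. The infimum is
  \<open>0\<close> if there are finitely many zeros, and \<open>\<infinity>\<close> if the series diverges for every exponent.
\<close>
definition convergence_exponent :: "(complex \<Rightarrow> complex) \<Rightarrow> ereal" where
  "convergence_exponent g =
     Inf (ereal ` {s. s > 0 \<and>
       (\<lambda>w. of_int (zorder g w) * norm w powr (-s)) summable_on {w. w \<noteq> 0 \<and> g w = 0}})"

definition borel_exceptional :: "real fps \<Rightarrow> complex \<Rightarrow> bool" where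
  "borel_exceptional f a \<longleftrightarrow>
     convergence_exponent (\<lambda>z. eval_complex f z - a) < growth_order f"

lemma pmf_khinchin:
  assumes f: "f \<in> class_K" and t: "0 \<le> t" "ereal t < fps_conv_radius f"
  shows "pmf (khinchin f t) n = fps_nth f n * t ^ n / eval_fps f t"
proof -
  have nn: "0 \<le> fps_nth f n * t ^ n" for n
    using f t by (auto simp: class_K_def)
  have sms: "(\<lambda>n. fps_nth f n * t ^ n) sums eval_fps f t"
    using sums_eval_fps[of t f] t by simp
  have pos: "eval_fps f t > 0"
  proof -
    have "(\<Sum>n<1. fps_nth f n * t ^ n) \<le> eval_fps f t"
      using sum_le_suminf[of "\<lambda>n. fps_nth f n * t ^ n" "{..<1}"] sms nn
      by (simp add: sums_iff)
    thus ?thesis using f by (simp add: class_K_def)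
  qed
  have nn': "0 \<le> fps_nth f n * t ^ n / eval_fps f t" for n
    using nn pos by simp
  have sms1: "(\<lambda>n. fps_nth f n * t ^ n / eval_fps f t) sums 1"
    using sums_divide[OF sms, of "eval_fps f t"] pos by simp
  have "(\<Sum>n. ennreal (fps_nth f n * t ^ n / eval_fps f t)) = ennreal 1"
    by (rule suminf_ennreal_eq[OF nn' sms1])
  hence "(\<integral>\<^sup>+n. ennreal (fps_nth f n * t ^ n / eval_fps f t) \<partial>count_space UNIV) = 1"
    by (simp add: nn_integral_count_space_nat)
  thus ?thesis
    unfolding khinchin_def by (intro pmf_embed_pmf nn')
qed

end

theory Submission
  imports Defs
begin

text \<open>
  If \<open>a\<close> is a Borel exceptional value, Hadamard factorization gives \<open>f - a = \<kappa> z^m e^Q G\<close>, where \<open>Q\<close> is a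
  polynomial of degree \<open>d\<close> with leading coefficient \<open>b\<close> and \<open>|G(z)| \<le> exp (C |z|^s)\<close> with \<open>s\<close> below the
  order of \<open>f\<close>, which forces \<open>s < d\<close>. Since \<open>f(t)\<close> is the maximum modulus on the circle of radius \<open>t\<close>
  and \<open>G\<close> cannot be small on a whole arc, \<open>ln f(t) \<sim> |b| t^d\<close>. Log-convexity allows this asymptotic
  relation to be differentiated, for \<open>f\<close> and for \<open>f'\<close>, and this yields \<open>E(X_t\<^sup>2) / E(X_t)\<^sup>2 \<longrightarrow> 1\<close>.
\<close>

subsection \<open>Regular growth implies the clan property\<close>

text \<open>The lower bound for ln f(t) is the delicate half. Since |f(z)| <= f(t) on the whole
  circle |z| = t, the point z may be chosen where b z^d is close to |b| t^d. But \<open>G\<close>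
  may vanish in any single direction, so an arc of angle 2 pi / n is searched instead. This costs a
  factor n in the exponent n C t^s, which for fixed n is negligible against t^d because s < d; a
  narrow arc can therefore be fixed before t tends to infinity. An asymptotic relation cannot be
  differentiated in general. Here x -> ln f(e^x) is convex, so its slope is caught between
  difference quotients taken on either side. Convexity pays for one derivative only. The second
  moment is therefore reached through f', again a series with nonnegative coefficients, and not
  through the second derivative of ln f.\<close>

lemma eval_fps_exp_mult_ge:
  fixes f :: "real fps"
  assumes conv: "fps_conv_radius f = \<infinity>" and nn: "\<And>n. fps_nth f n \<ge> 0"
    and t: "t > 0" and pos: "eval_fps f t > 0"
  shows "eval_fps f t * exp (h * (t * eval_fps (fps_deriv f) t / eval_fps f t))
           \<le> eval_fps f (exp h * t)"
proof -
  define \<mu> where "\<mu> = t * eval_fps (fps_deriv f) t / eval_fps f t"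
  have s0: "(\<lambda>n. fps_nth f n * t ^ n) sums eval_fps f t"
    using sums_eval_fps[of t f] conv by simp
  have s1: "(\<lambda>n. fps_nth f n * (exp h * t) ^ n) sums eval_fps f (exp h * t)"
    using sums_eval_fps[of "exp h * t" f] conv by simp
  have "(\<lambda>n. fps_nth (fps_deriv f) n * t ^ n) sums eval_fps (fps_deriv f) t"
    using sums_eval_fps[of t "fps_deriv f"] fps_conv_radius_deriv[of f] conv by simp
  from sums_mult[OF this, of t]
  have "(\<lambda>n. real (Suc n) * fps_nth f (Suc n) * t ^ Suc n) sums (t * eval_fps (fps_deriv f) t)"
    by (simp add: algebra_simps)
  then have s2: "(\<lambda>n. real n * fps_nth f n * t ^ n) sums (t * eval_fps (fps_deriv f) t)"
    using sums_Suc[of "\<lambda>n. real n * fps_nth f n * t ^ n"] by simp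
  have eq: "t * eval_fps (fps_deriv f) t = \<mu> * eval_fps f t"
    using pos by (simp add: \<mu>_def)
  \<comment> \<open>This is Jensen's inequality for exp (h X_t), done term by term: exp (h n) lies
    above its tangent at n = \<open>\<mu>\<close>, and the linear part of the tangent sums to zero
    because \<open>\<mu>\<close> is the mean. The sign of \<open>h\<close> is arbitrary.\<close>
  have s3: "(\<lambda>n. exp (h * \<mu>) * (fps_nth f n * t ^ n + h * (real n * fps_nth f n * t ^ n - \<mu> * (fps_nth f n * t ^ n))))
        sums (exp (h * \<mu>) * (eval_fps f t + h * (t * eval_fps (fps_deriv f) t - \<mu> * eval_fps f t)))"
    by (intro sums_mult sums_add sums_diff s0 s2)
  have "exp (h * \<mu>) * (fps_nth f n * t ^ n + h * (real n * fps_nth f n * t ^ n - \<mu> * (fps_nth f n * t ^ n)))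
        \<le> fps_nth f n * (exp h * t) ^ n" for n
  proof -
    have "exp (h * \<mu>) * (1 + h * (real n - \<mu>)) \<le> exp (h * \<mu>) * exp (h * (real n - \<mu>))"
      by (intro mult_left_mono exp_ge_add_one_self) auto
    also have "\<dots> = exp h ^ n"
      by (simp add: exp_add[symmetric] exp_of_nat_mult[symmetric] algebra_simps)
    finally have "(fps_nth f n * t ^ n) * (exp (h * \<mu>) * (1 + h * (real n - \<mu>)))
                     \<le> (fps_nth f n * t ^ n) * exp h ^ n"
      using nn[of n] t by (intro mult_left_mono) auto
    then show ?thesis by (simp add: algebra_simps)
  qed
  from sums_le[OF this s3 s1] show ?thesis
    unfolding \<mu>_def[symmetric] eq using pos by (simp add: mult.commute)
qed

lemma expm1_quotient_tendsto: "((\<lambda>h. (exp (a * h) - 1) / h) \<longlongrightarrow> (a::real)) (at 0)"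
proof -
  have "((\<lambda>h. exp (a * h)) has_real_derivative a) (at 0)"
    by (auto intro!: derivative_eq_intros)
  then show ?thesis by (simp add: has_field_derivative_iff)
qed

text \<open>With \<open>D h t\<close> the increment of ln F from t to e^h t, the tangent inequality
  gives \<open>D h t\<close> / h as an upper bound for \<open>\<mu> t\<close> when h > 0 and as a
  lower bound when h < 0. For fixed h the quotient divided by t^d tends to c (e^(d h) - 1) / h, and
  h -> 0 from either side gives c d. Positivity is asked only for t > 0, so that the lemma also
  applies to f', whose constant term may vanish.\<close>

lemma log_deriv_asymp:
  fixes f :: "real fps"
  assumes conv: "fps_conv_radius f = \<infinity>" and nn: "\<And>n. fps_nth f n \<ge> 0"
    and pos: "\<And>t. t > 0 \<Longrightarrow> eval_fps f t > 0"
    and lim: "((\<lambda>t. ln (eval_fps f t) / t ^ d) \<longlongrightarrow> c) at_top"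
  shows "((\<lambda>t. t * eval_fps (fps_deriv f) t / eval_fps f t / t ^ d) \<longlongrightarrow> c * d) at_top"
proof -
  define F where "F = eval_fps f"
  define \<mu> where "\<mu> = (\<lambda>t. t * eval_fps (fps_deriv f) t / F t)"
  define D where "D = (\<lambda>h t. ln (F (exp h * t)) - ln (F t))"
  have D_ge: "D h t \<ge> h * \<mu> t" if "t > 0" for h t
  proof -
    have "ln (F t * exp (h * \<mu> t)) \<le> ln (F (exp h * t))"
      using eval_fps_exp_mult_ge[OF conv nn that pos[OF that], of h] pos[OF that] pos[of "exp h * t"] that
      by (simp add: \<mu>_def F_def)
    then show ?thesis
      using pos[OF that] by (simp add: D_def ln_mult F_def)
  qed
  have D_lim: "((\<lambda>t. D h t / t ^ d / h) \<longlongrightarrow> c * ((exp (real d * h) - 1) / h)) at_top" if "h \<noteq> 0" for h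
  proof -
    have "filterlim (\<lambda>t. exp h * t) at_top at_top"
      by (rule filterlim_tendsto_pos_mult_at_top[OF tendsto_const]) (auto intro: filterlim_ident)
    from filterlim_compose[OF lim this]
    have "((\<lambda>t. (exp h ^ d * (ln (F (exp h * t)) / (exp h * t) ^ d) - ln (F t) / t ^ d) / h)
             \<longlongrightarrow> (exp h ^ d * c - c) / h) at_top"
      using that by (intro tendsto_intros lim[folded F_def]) (auto simp: F_def)
    moreover have "(exp h ^ d * (ln (F (exp h * t)) / (exp h * t) ^ d) - ln (F t) / t ^ d) / h
          = D h t / t ^ d / h" for t
      by (simp add: D_def power_mult_distrib diff_divide_distrib)
    moreover have "(exp h ^ d * c - c) / h = c * ((exp (real d * h) - 1) / h)"
      by (simp add: exp_of_nat_mult[symmetric] algebra_simps)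
    ultimately show ?thesis by simp
  qed
  have E: "((\<lambda>h. c * ((exp (real d * h) - 1) / h)) \<longlongrightarrow> c * d) (at 0)"
    by (intro tendsto_intros expm1_quotient_tendsto)
  have "((\<lambda>t. \<mu> t / t ^ d) \<longlongrightarrow> c * d) at_top"
  proof (rule order_tendstoI)
    fix y assume "y < c * d"
    then have "eventually (\<lambda>h. y < c * ((exp (real d * h) - 1) / h)) (at_left 0)"
      using order_tendstoD(1)[OF E] by (simp add: eventually_at_split)
    then obtain h where h: "h < 0" "y < c * ((exp (real d * h) - 1) / h)"
      unfolding eventually_at_left_field by (metis dense)
    then have "eventually (\<lambda>t. y < D h t / t ^ d / h) at_top"
      using order_tendstoD(1)[OF D_lim[of h]] by auto
    then show "eventually (\<lambda>t. y < \<mu> t / t ^ d) at_top"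
      using eventually_gt_at_top[of 0]
    proof eventually_elim
      case (elim t)
      have "D h t / t ^ d / h \<le> \<mu> t / t ^ d"
        using D_ge[of t h] elim h by (simp add: field_simps)
      then show ?case using elim by linarith
    qed
  next
    fix y assume "y > c * d"
    then have "eventually (\<lambda>h. y > c * ((exp (real d * h) - 1) / h)) (at_right 0)"
      using order_tendstoD(2)[OF E] by (simp add: eventually_at_split)
    then obtain h where h: "h > 0" "y > c * ((exp (real d * h) - 1) / h)"
      unfolding eventually_at_right_field by (metis dense)
    then have "eventually (\<lambda>t. y > D h t / t ^ d / h) at_top"
      using order_tendstoD(2)[OF D_lim[of h]] by auto
    then show "eventually (\<lambda>t. y > \<mu> t / t ^ d) at_top"
      using eventually_gt_at_top[of 0]
    proof eventually_elim
      case (elim t)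
      have "D h t / t ^ d / h \<ge> \<mu> t / t ^ d"
        using D_ge[of t h] elim h by (simp add: field_simps)
      then show ?case using elim by linarith
    qed
  qed
  then show ?thesis by (simp add: \<mu>_def F_def)
qed

section \<open>Positivity of the series and moments of the Khinchin family\<close>

lemma eval_fps_pos:
  fixes f :: "real fps"
  assumes conv: "fps_conv_radius f = \<infinity>" and nn: "\<And>n. fps_nth f n \<ge> 0"
    and "fps_nth f k > 0" "t > 0"
  shows "eval_fps f t \<ge> fps_nth f k * t ^ k" "eval_fps f t > 0"
proof -
  have s: "(\<lambda>n. fps_nth f n * t ^ n) sums eval_fps f t"
    using sums_eval_fps[of t f] conv by simp
  have "sum (\<lambda>n. fps_nth f n * t ^ n) {k} \<le> (\<Sum>n. fps_nth f n * t ^ n)"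
    using s nn assms by (intro sum_le_suminf) (auto simp: sums_iff)
  then show *: "eval_fps f t \<ge> fps_nth f k * t ^ k"
    using s by (simp add: sums_iff)
  have "fps_nth f k * t ^ k > 0" using assms by simp
  then show "eval_fps f t > 0" using * by linarith
qed

text \<open>Nonnegative terms make convergence of the series the same as integrability, so one
  identity of sums yields both conclusions. It serves the first and the second moment.\<close>

lemma khinchin_moment:
  assumes f: "f \<in> class_K" "entire_fps f" and t: "t \<ge> 0" 
    and nn: "\<And>n. g n \<ge> 0" and s: "(\<lambda>n. g n * (fps_nth f n * t ^ n)) sums S"
  shows "integrable (measure_pmf (khinchin f t)) g"
    and "measure_pmf.expectation (khinchin f t) g = S / eval_fps f t"
proof -
  have pmf: "pmf (khinchin f t) n = fps_nth f n * t ^ n / eval_fps f t" for n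
    using pmf_khinchin[OF f(1) t] f(2) by (simp add: entire_fps_def)
  have s': "(\<lambda>n. pmf (khinchin f t) n * g n) sums (S / eval_fps f t)"
    using sums_divide[OF s, of "eval_fps f t"] by (simp add: pmf mult_ac)
  then have int: "integrable (count_space UNIV) (\<lambda>n. pmf (khinchin f t) n * g n)"
    using nn by (simp add: integrable_count_space_nat_iff sums_iff abs_mult)
  then show "integrable (measure_pmf (khinchin f t)) g"
    by (subst measure_pmf_eq_density, subst integrable_density) auto
  have "measure_pmf.expectation (khinchin f t) g
      = (\<integral>n. pmf (khinchin f t) n * g n \<partial>count_space UNIV)"
    by (subst measure_pmf_eq_density, subst integral_density) auto
  also have "\<dots> = S / eval_fps f t"
    using sums_integral_count_space_nat[OF int] s' sums_unique2 by blast
  finally show "measure_pmf.expectation (khinchin f t) g = S / eval_fps f t" .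
qed

lemma khinchin_mean_sd:
  assumes f: "f \<in> class_K" "entire_fps f" and t: "t > 0"
  shows "khinchin_mean f t = t * eval_fps (fps_deriv f) t / eval_fps f t"
    and "khinchin_sd f t = sqrt ((t * eval_fps (fps_deriv f) t
            + t\<^sup>2 * eval_fps (fps_deriv (fps_deriv f)) t) / eval_fps f t - (khinchin_mean f t)\<^sup>2)"
proof -
  have cv: "fps_conv_radius f = \<infinity>" "fps_conv_radius (fps_deriv f) = \<infinity>"
      "fps_conv_radius (fps_deriv (fps_deriv f)) = \<infinity>"
    using f fps_conv_radius_deriv[of f] fps_conv_radius_deriv[of "fps_deriv f"]
    by (auto simp: entire_fps_def)
  have "(\<lambda>n. fps_nth (fps_deriv f) n * t ^ n) sums eval_fps (fps_deriv f) t"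
    using sums_eval_fps[of t "fps_deriv f"] cv by simp
  from sums_mult[OF this, of t]
  have "(\<lambda>n. real (Suc n) * (fps_nth f (Suc n) * t ^ Suc n)) sums (t * eval_fps (fps_deriv f) t)"
    by (simp add: algebra_simps)
  then have s1: "(\<lambda>n. real n * (fps_nth f n * t ^ n)) sums (t * eval_fps (fps_deriv f) t)"
    using sums_Suc[of "\<lambda>n. real n * (fps_nth f n * t ^ n)"] by simp
  have "(\<lambda>n. fps_nth (fps_deriv (fps_deriv f)) n * t ^ n) sums eval_fps (fps_deriv (fps_deriv f)) t"
    using sums_eval_fps[of t "fps_deriv (fps_deriv f)"] cv by simp
  from sums_mult[OF this, of "t\<^sup>2"]
  have "(\<lambda>n. real (Suc (Suc n)) * real (Suc n) * (fps_nth f (Suc (Suc n)) * t ^ Suc (Suc n)))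
      sums (t\<^sup>2 * eval_fps (fps_deriv (fps_deriv f)) t)"
    by (simp add: algebra_simps power2_eq_square)
  \<comment> \<open>The factor n (n - 1) vanishes at n = 0 and n = 1, so undoing the two index
    shifts adds no terms.\<close>
  then have s2: "(\<lambda>n. real n * (real n - 1) * (fps_nth f n * t ^ n))
      sums (t\<^sup>2 * eval_fps (fps_deriv (fps_deriv f)) t)"
    using sums_Suc[of "\<lambda>n. real (Suc n) * real n * (fps_nth f (Suc n) * t ^ Suc n)"]
      sums_Suc[of "\<lambda>n. real n * (real n - 1) * (fps_nth f n * t ^ n)"] by simp
  have s3: "(\<lambda>n. (real n)\<^sup>2 * (fps_nth f n * t ^ n))
      sums (t * eval_fps (fps_deriv f) t + t\<^sup>2 * eval_fps (fps_deriv (fps_deriv f)) t)"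
    using sums_add[OF s1 s2] by (simp add: algebra_simps power2_eq_square)
  show m: "khinchin_mean f t = t * eval_fps (fps_deriv f) t / eval_fps f t"
    using khinchin_moment(2)[OF f _ _ s1] t by (simp add: khinchin_mean_def)
  have "measure_pmf.variance (khinchin f t) real
      = measure_pmf.expectation (khinchin f t) (\<lambda>n. (real n)\<^sup>2)
        - (measure_pmf.expectation (khinchin f t) real)\<^sup>2"
    using khinchin_moment(1)[OF f _ _ s1] khinchin_moment(1)[OF f _ _ s3] t
    by (intro measure_pmf.variance_eq) auto
  then show "khinchin_sd f t = sqrt ((t * eval_fps (fps_deriv f) t
            + t\<^sup>2 * eval_fps (fps_deriv (fps_deriv f)) t) / eval_fps f t - (khinchin_mean f t)\<^sup>2)"
    using khinchin_moment(2)[OF f _ _ s3] t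
    by (simp add: khinchin_sd_def khinchin_mean_def)
qed

text \<open>
  With \<open>\<Lambda> g = t g' / g\<close>, the mean is \<open>\<Lambda> f\<close> and \<open>E (X\<^sup>2) / E (X)\<^sup>2 = (1 + \<Lambda> f') / \<Lambda> f\<close>; since
  \<open>ln f' \<sim> ln f\<close>, both \<open>\<Lambda> f\<close> and \<open>\<Lambda> f'\<close> are asymptotic to \<open>c d t ^ d\<close>.
\<close>
lemma clan_if_regular_growth:
  assumes f: "f \<in> class_K" "entire_fps f"
    and d: "d > 0" and c: "c > 0"
    and lim: "((\<lambda>t. ln (eval_fps f t) / t ^ d) \<longlongrightarrow> c) at_top"
  shows "clan f"
proof -
  define F where "F = eval_fps f"
  define F' where "F' = eval_fps (fps_deriv f)"
  define F'' where "F'' = eval_fps (fps_deriv (fps_deriv f))"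
  define \<mu> where "\<mu> = (\<lambda>t. t * F' t / F t)"
  define \<nu> where "\<nu> = (\<lambda>t. t * F'' t / F' t)"
  have cv: "fps_conv_radius f = \<infinity>" "fps_conv_radius (fps_deriv f) = \<infinity>"
    using f fps_conv_radius_deriv[of f] by (auto simp: entire_fps_def)
  have nn: "fps_nth f n \<ge> 0" for n using f by (auto simp: class_K_def)
  have nn': "fps_nth (fps_deriv f) n \<ge> 0" for n using nn by simp
  have Fpos: "F t > 0" if "t > 0" for t
    unfolding F_def using f that by (intro eval_fps_pos[OF cv(1) nn, of 0]) (auto simp: class_K_def)
  obtain n where n: "n > 0" "fps_nth f n \<noteq> 0" using f by (auto simp: class_K_def)
  then have n': "fps_nth (fps_deriv f) (n - 1) > 0" using nn[of n] by simp
  have F'pos: "F' t > 0" if "t > 0" for t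
    unfolding F'_def using that by (intro eval_fps_pos[OF cv(2) nn' n'])
  have td: "filterlim (\<lambda>t. t ^ d :: real) at_top at_top"
    using d by (intro filterlim_pow_at_top filterlim_ident) auto
  have L1: "((\<lambda>t. \<mu> t / t ^ d) \<longlongrightarrow> c * d) at_top"
    using log_deriv_asymp[OF cv(1) nn Fpos[unfolded F_def] lim] by (simp add: \<mu>_def F_def F'_def)
  have l0: "((\<lambda>t::real. ln (t ^ d) / t ^ d) \<longlongrightarrow> 0) at_top"
    by (rule filterlim_compose[OF ln_x_over_x_tendsto_0 td])
  have l1: "((\<lambda>t. inverse (t ^ d) :: real) \<longlongrightarrow> 0) at_top"
    by (rule filterlim_compose[OF tendsto_inverse_0_at_top[OF filterlim_ident] td])
  have l2: "((\<lambda>t. ln (\<mu> t / t ^ d)) \<longlongrightarrow> ln (c * d)) at_top"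
    using c d by (intro tendsto_ln L1) auto
  \<comment> \<open>This is ln F' = ln F + ln \<open>\<mu>\<close> - ln t divided by t^d. The
    logarithm of t is written as ln (t^d) / d, so that every error term is covered by ln x / x -> 0
    or 1 / x -> 0 along x = t^d.\<close>
  have "((\<lambda>t. ln (F t) / t ^ d + (ln (\<mu> t / t ^ d) * inverse (t ^ d)
       + (ln (t ^ d) / t ^ d - (ln (t ^ d) / t ^ d) / d))) \<longlongrightarrow> c + (ln (c * d) * 0 + (0 - 0 / d))) at_top"
    using d by (intro tendsto_add[OF lim[folded F_def]] tendsto_add[OF tendsto_mult[OF l2 l1]]
        tendsto_diff[OF l0] tendsto_divide[OF l0 tendsto_const]) auto
  moreover have "eventually (\<lambda>t. ln (F t) / t ^ d + (ln (\<mu> t / t ^ d) * inverse (t ^ d)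
       + (ln (t ^ d) / t ^ d - (ln (t ^ d) / t ^ d) / d)) = ln (F' t) / t ^ d) at_top"
    using eventually_gt_at_top[of 0]
  proof eventually_elim
    case (elim t)
    have "ln (\<mu> t / t ^ d) = ln t + ln (F' t) - ln (F t) - d * ln t"
      using elim Fpos[of t] F'pos[of t] by (simp add: \<mu>_def ln_mult ln_div ln_realpow)
    then show ?case using elim d by (simp add: field_simps ln_realpow)
  qed
  ultimately have "((\<lambda>t. ln (F' t) / t ^ d) \<longlongrightarrow> c) at_top"
    by (simp add: tendsto_cong)
  from log_deriv_asymp[OF cv(2) nn' F'pos[unfolded F'_def] this[unfolded F'_def]]
  have L2: "((\<lambda>t. \<nu> t / t ^ d) \<longlongrightarrow> c * d) at_top"
    by (simp add: \<nu>_def F''_def F'_def)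
  have "((\<lambda>t. sqrt ((inverse (t ^ d) + \<nu> t / t ^ d) / (\<mu> t / t ^ d) - 1)) \<longlongrightarrow> sqrt ((0 + c * d) / (c * d) - 1)) at_top"
    using c d by (intro tendsto_real_sqrt tendsto_diff tendsto_const tendsto_divide[OF tendsto_add[OF l1 L2] L1]) auto
  then have "((\<lambda>t. sqrt ((inverse (t ^ d) + \<nu> t / t ^ d) / (\<mu> t / t ^ d) - 1)) \<longlongrightarrow> 0) at_top"
    using c d by simp
  moreover have "eventually (\<lambda>t. sqrt ((inverse (t ^ d) + \<nu> t / t ^ d) / (\<mu> t / t ^ d) - 1)
        = khinchin_sd f t / khinchin_mean f t) at_top"
    using eventually_gt_at_top[of 0]
  proof eventually_elim
    case (elim t)
    have \<mu>: "khinchin_mean f t = \<mu> t" "\<mu> t > 0"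
      using khinchin_mean_sd(1)[OF f elim] Fpos[OF elim] F'pos[OF elim] elim by (auto simp: \<mu>_def F_def F'_def)
    have "khinchin_sd f t / khinchin_mean f t
        = sqrt (((t * F' t + t\<^sup>2 * F'' t) / F t - (\<mu> t)\<^sup>2) / (\<mu> t)\<^sup>2)"
      using khinchin_mean_sd(2)[OF f elim] \<mu>
      by (simp add: real_sqrt_divide F_def F'_def F''_def)
    also have "((t * F' t + t\<^sup>2 * F'' t) / F t - (\<mu> t)\<^sup>2) / (\<mu> t)\<^sup>2
        = (t * F' t + t\<^sup>2 * F'' t) / F t / (\<mu> t)\<^sup>2 - 1"
      using \<mu> by (simp add: diff_divide_distrib)
    also have "(t * F' t + t\<^sup>2 * F'' t) / F t = \<mu> t * (1 + \<nu> t)"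
      using Fpos[OF elim] F'pos[OF elim] elim by (simp add: \<mu>_def \<nu>_def field_simps power2_eq_square)
    also have "\<mu> t * (1 + \<nu> t) / (\<mu> t)\<^sup>2 = (inverse (t ^ d) + \<nu> t / t ^ d) / (\<mu> t / t ^ d)"
      using \<mu> elim by (simp add: field_simps power2_eq_square)
    finally show ?case by simp
  qed
  ultimately have "((\<lambda>t. khinchin_sd f t / khinchin_mean f t) \<longlongrightarrow> 0) at_top"
    by (rule Lim_transform_eventually)
  then show ?thesis using f by (simp add: clan_def)
qed

subsection \<open>Growth and zeros of entire functions\<close>

text \<open>The condition p < s <= p + 1 serves both regimes. For small u the factor differs from 1
  by O(|u|^(p+1)), which is O(|u|^s) as s <= p + 1. For large u the exponential polynomial has
  degree p < s.\<close>

lemma norm_weierstrass_factor_le: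
  fixes s :: real
  assumes s: "real p < s" "s \<le> real p + 1"
  obtains C where "C \<ge> 0" "\<And>u. norm (weierstrass_factor p u) \<le> exp (C * norm u powr s)"
proof
  have s0: "s > 0" using s by linarith
  \<comment> \<open>The summand 3 belongs to |u| <= 1/2. For |u| > 1/2, p 2^s bounds the polynomial
    in the exponent, where 2 |u| > 1 allows each power to be raised to s, and 4^s / s comes from ln
    x <= x^s / s at x = 4 |u|.\<close>
  define C where "C = 3 + real p * 2 powr s + 4 powr s / s"
  show "C \<ge> 0" using s0 by (simp add: C_def)
  fix u :: complex
  show "norm (weierstrass_factor p u) \<le> exp (C * norm u powr s)"
  proof (cases "norm u \<le> 1 / 2")
    case True
    show ?thesis
    proof (cases "u = 0")
      case False
      have "norm (weierstrass_factor p u) \<le> 1 + norm (weierstrass_factor p u - 1)"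
        using norm_triangle_ineq[of 1 "weierstrass_factor p u - 1"] by simp
      also have "\<dots> \<le> 1 + 3 * norm u ^ Suc p"
        using weierstrass_factor_bound[OF True, of p] by simp
      also have "norm u ^ Suc p = norm u powr (real p + 1)"
        using False by (simp add: powr_realpow[symmetric] powr_add)
      also have "norm u powr (real p + 1) \<le> norm u powr s"
        using True s by (intro powr_mono') auto
      also have "1 + 3 * norm u powr s \<le> exp (3 * norm u powr s)"
        by (rule exp_ge_add_one_self)
      also have "3 * norm u powr s \<le> C * norm u powr s"
        using s0 by (intro mult_right_mono) (auto simp: C_def)
      finally show ?thesis by simp
    qed simp
  next
    case False
    then have u: "norm u > 1 / 2" by simp
    have pw: "norm u ^ k \<le> 2 powr s * norm u powr s" if "k \<le> p" for k
    proof -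
      have "norm u ^ k \<le> (2 * norm u) ^ k" by (intro power_mono) auto
      also have "\<dots> = (2 * norm u) powr real k" using u by (subst powr_realpow) auto
      also have "\<dots> \<le> (2 * norm u) powr s" using u s that by (intro powr_mono) auto
      finally show ?thesis by (simp add: powr_mult)
    qed
    have "norm (\<Sum>k=1..p. u ^ k / of_nat k) \<le> (\<Sum>k=1..p. norm u ^ k / real k)"
      by (rule order_trans[OF norm_sum]) (simp add: norm_divide norm_power)
    also have "\<dots> \<le> (\<Sum>k=1..p. 2 powr s * norm u powr s)"
    proof (rule sum_mono)
      fix k assume k: "k \<in> {1..p}"
      have "norm u ^ k / real k \<le> norm u ^ k / 1" using k by (intro divide_left_mono) auto
      also have "\<dots> \<le> 2 powr s * norm u powr s" using pw[of k] k by simp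
      finally show "norm u ^ k / real k \<le> 2 powr s * norm u powr s" .
    qed
    finally have A: "norm (\<Sum>k=1..p. u ^ k / of_nat k) \<le> real p * 2 powr s * norm u powr s" by simp
    have "ln (4 * norm u) \<le> (4 * norm u) powr s / s"
      using u s0 by (intro ln_powr_bound) auto
    then have "exp (ln (4 * norm u)) \<le> exp (4 powr s / s * norm u powr s)"
      by (simp add: powr_mult)
    then have "4 * norm u \<le> exp (4 powr s / s * norm u powr s)"
      using u by (subst (asm) exp_ln) auto
    moreover have "norm (1 - u) \<le> 4 * norm u"
      using norm_triangle_ineq4[of 1 u] u by simp
    ultimately have B: "norm (1 - u) \<le> exp (4 powr s / s * norm u powr s)" by linarith
    have "norm (weierstrass_factor p u) \<le> norm (1 - u) * exp (norm (\<Sum>k=1..p. u ^ k / of_nat k))"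
      unfolding weierstrass_factor_def norm_mult by (intro mult_left_mono norm_exp) auto
    also have "\<dots> \<le> exp (4 powr s / s * norm u powr s) * exp (real p * 2 powr s * norm u powr s)"
      using A B by (intro mult_mono) auto
    also have "\<dots> = exp ((4 powr s / s + real p * 2 powr s) * norm u powr s)"
      by (simp add: exp_add[symmetric] algebra_simps)
    also have "\<dots> \<le> exp (C * norm u powr s)"
      by (simp add: C_def mult_right_mono)
    finally show ?thesis .
  qed
qed

section \<open>Taylor coefficients under a one-sided bound on the real part\<close>

text \<open>Schwarz's lemma is applied to \<open>f\<close> followed by w / (2 M - w), which maps the
  half-plane Re w < M to the unit disc and fixes 0. On the disc of half radius the image has modulus
  at most 1/2, and solving |f| <= (2 M + |f|) / 2 gives the constant.\<close>

lemma Borel_Caratheodory_half: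
  assumes hol: "f holomorphic_on ball 0 R" and R: "R > 0" and f0: "f 0 = 0"
    and M: "M > 0" and Re_le: "\<And>z. z \<in> ball 0 R \<Longrightarrow> Re (f z) \<le> M"
    and z: "norm z \<le> R / 2"
  shows "norm (f z) \<le> 2 * M"
proof -
  define g where "g = (\<lambda>w. f (of_real R * w) / (2 * of_real M - f (of_real R * w)))"
  have in_ball: "of_real R * w \<in> ball 0 R" if "norm w < 1" for w :: complex
    using that R by (simp add: norm_mult)
  have less: "norm (f w) \<le> norm (2 * of_real M - f w)" "2 * of_real M - f w \<noteq> 0" if "w \<in> ball 0 R" for w
  proof -
    have "\<bar>Re (f w)\<bar> \<le> \<bar>2 * M - Re (f w)\<bar>" using Re_le[OF that] M by linarith
    then have "(Re (f w))\<^sup>2 \<le> (2 * M - Re (f w))\<^sup>2" by (simp add: abs_le_square_iff)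
    then show "norm (f w) \<le> norm (2 * of_real M - f w)"
      by (simp add: cmod_def)
    have "Re (2 * of_real M - f w) > 0" using Re_le[OF that] M by simp
    then show "2 * of_real M - f w \<noteq> 0" by force
  qed
  have holR: "(\<lambda>w. f (of_real R * w)) holomorphic_on ball 0 1"
    using in_ball by (intro holomorphic_on_compose_gen[OF _ hol, unfolded o_def] holomorphic_intros) auto
  have holg: "g holomorphic_on ball 0 1"
    unfolding g_def using less(2) in_ball by (intro holomorphic_intros holR) auto
  have g0: "g 0 = 0" by (simp add: g_def f0)
  have le1: "norm (g w) \<le> 1" if "norm w < 1" for w
    using less[OF in_ball[OF that]] by (simp add: g_def norm_divide divide_simps)
  \<comment> \<open>The hypothesis allows Re f = M, hence |g| = 1; an interior point with |g| = 1
    would make \<open>g\<close> constant, against \<open>g 0 = 0\<close>.\<close>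
  have lt1: "norm (g w) < 1" if w: "norm w < 1" for w
  proof (rule ccontr)
    assume "\<not> norm (g w) < 1"
    then have "norm (g w) = 1" using le1[OF w] by linarith
    then have "g constant_on ball 0 1"
      using holg le1 w by (intro maximum_modulus_principle[of g "ball 0 1" "ball 0 1" w]) auto
    then have "g w = g 0" using w by (auto simp: constant_on_def)
    then show False using \<open>norm (g w) = 1\<close> g0 by simp
  qed
  define w where "w = z / of_real R"
  have w: "norm w \<le> 1 / 2" using z R by (simp add: w_def norm_divide field_simps)
  have "norm (g w) \<le> norm w"
    using w by (intro Schwarz_Lemma(1)[OF holg g0 lt1]) auto
  then have gw: "norm (g w) \<le> 1 / 2" using w by linarith
  have zw: "of_real R * w = z" using R by (simp add: w_def)
  have zb: "z \<in> ball 0 R" using z R by simp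
  have "f z = g w * (2 * of_real M - f z)"
    using less(2)[OF zb] by (simp add: g_def zw)
  then have "norm (f z) = norm (g w) * norm (2 * of_real M - f z)"
    by (metis norm_mult)
  also have "\<dots> \<le> (1 / 2) * (2 * M + norm (f z))"
    using gw norm_triangle_ineq4[of "2 * of_real M" "f z"] M
    by (intro mult_mono) auto
  finally show ?thesis by (simp add: field_simps)
qed

lemma holomorphic_coeff_bound:
  assumes hol: "f holomorphic_on ball 0 R" and R: "R > 0" and f0: "f 0 = 0"
    and M: "M > 0" and Re_le: "\<And>z. z \<in> ball 0 R \<Longrightarrow> Re (f z) \<le> M"
  shows "norm ((deriv ^^ k) f 0 / fact k) \<le> 2 * M / (R / 2) ^ k"
proof -
  have "norm ((deriv ^^ k) f 0) \<le> fact k * (2 * M) / (R / 2) ^ k"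
  proof (rule Cauchy_inequality)
    show "f holomorphic_on ball 0 (R / 2)"
      by (rule holomorphic_on_subset[OF hol]) (use R in auto)
    show "continuous_on (cball 0 (R / 2)) f"
      by (rule continuous_on_subset[OF holomorphic_on_imp_continuous_on[OF hol]]) (use R in auto)
    show "norm (f x) \<le> 2 * M" if "norm (0 - x) = R / 2" for x
      using Borel_Caratheodory_half[OF assms] that by simp
  qed (use R in auto)
  then show ?thesis by (simp add: norm_divide field_simps)
qed

section \<open>Dividing out finitely many zeros, and extracting convergent subsequences\<close>

text \<open>If \<open>g w\<close> is nonzero, the order is 0 and the factor is 1. The invariance of
  the other orders drives the induction over a finite set of zeros, and later carries the sum over
  the zeros of f - a over to the quotient by z^m.\<close>

lemma entire_zero_factor:
  assumes g: "g holomorphic_on UNIV" and nz: "\<exists>z. g z \<noteq> 0"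
  obtains h where "h holomorphic_on UNIV" "h w \<noteq> 0"
    "\<And>z. g z = (z - w) ^ nat (zorder g w) * h z" "\<And>v. v \<noteq> w \<Longrightarrow> zorder h v = zorder g v"
proof -
  define k where "k = nat (zorder g w)"
  obtain r where r: "r > 0" "zor_poly g w holomorphic_on cball w r"
    and eq: "\<And>z. z \<in> cball w r \<Longrightarrow> g z = zor_poly g w z * (z - w) ^ k \<and> zor_poly g w z \<noteq> 0"
    using zorder_exist_zero[OF g open_UNIV connected_UNIV UNIV_I, of w] nz unfolding k_def by blast
  define h where "h = (\<lambda>z. if z = w then zor_poly g w w else g z / (z - w) ^ k)"
  have "h holomorphic_on ball w r"
    by (rule holomorphic_transform[OF holomorphic_on_subset[OF r(2)]]) (use eq in \<open>auto simp: h_def\<close>)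
  moreover have "(\<lambda>z. g z / (z - w) ^ k) holomorphic_on -{w}"
    by (intro holomorphic_intros holomorphic_on_subset[OF g]) auto
  then have "h holomorphic_on -{w}"
    by (rule holomorphic_transform) (auto simp: h_def)
  ultimately have "h holomorphic_on (ball w r \<union> -{w})"
    by (intro holomorphic_on_Un) auto
  moreover have "ball w r \<union> -{w} = UNIV" using r(1) by auto
  ultimately have hol: "h holomorphic_on UNIV" by simp
  have hw: "h w \<noteq> 0" using eq[of w] r by (simp add: h_def)
  have g_eq: "g z = (z - w) ^ k * h z" for z
    using eq[of w] r(1) by (cases "z = w"; cases "k = 0") (auto simp: h_def)
  have "zorder h v = zorder g v" if "v \<noteq> w" for v
  proof -
    obtain z0 where z0: "g z0 \<noteq> 0" using nz by auto
    have "eventually (\<lambda>z. g z \<noteq> 0) (at v)"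
      using non_zero_neighbour_alt[OF g, of v z0] z0 by (auto elim: eventually_mono)
    then have "zorder (\<lambda>z. (z - w) ^ k * h z) v = zorder (\<lambda>z. (z - w) ^ k) v + zorder h v"
      using hol by (intro zorder_times_analytic) (auto simp: g_eq intro!: analytic_intros holomorphic_on_imp_analytic_at)
    also have "(\<lambda>z. (z - w) ^ k * h z) = g" using g_eq by auto
    also have "zorder (\<lambda>z. (z - w) ^ k) v = 0"
      using that by (intro zorder_eq_0I) (auto intro!: analytic_intros)
    finally show ?thesis by simp
  qed
  then show ?thesis using that[OF hol hw] g_eq unfolding k_def by blast
qed

lemma entire_zeros_factor:
  assumes g: "g holomorphic_on UNIV" and nz: "\<exists>z. g z \<noteq> 0" and "finite Z"
  shows "\<exists>h. h holomorphic_on UNIV \<and> (\<forall>w\<in>Z. h w \<noteq> 0) \<and>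
    (\<forall>z. g z = (\<Prod>w\<in>Z. (z - w) ^ nat (zorder g w)) * h z) \<and> (\<forall>v. v \<notin> Z \<longrightarrow> zorder h v = zorder g v)"
  using \<open>finite Z\<close>
proof induction
  case empty
  then show ?case using g by auto
next
  case (insert w Z)
  then obtain h where h: "h holomorphic_on UNIV" "\<And>w. w \<in> Z \<Longrightarrow> h w \<noteq> 0"
    "\<And>z. g z = (\<Prod>w\<in>Z. (z - w) ^ nat (zorder g w)) * h z" "\<And>v. v \<notin> Z \<Longrightarrow> zorder h v = zorder g v"
    by blast
  have "\<exists>z. h z \<noteq> 0" using nz h(3) by force
  from entire_zero_factor[OF h(1) this, of w] obtain h' where h': "h' holomorphic_on UNIV" "h' w \<noteq> 0"
    "\<And>z. h z = (z - w) ^ nat (zorder h w) * h' z" "\<And>v. v \<noteq> w \<Longrightarrow> zorder h' v = zorder h v"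
    by blast
  have "h' v \<noteq> 0" if "v \<in> insert w Z" for v
    using that h'(2,3) h(2)[of v] by auto
  moreover have "g z = (\<Prod>w\<in>insert w Z. (z - w) ^ nat (zorder g w)) * h' z" for z
    using h(3)[of z] h'(3)[of z] h(4)[of w] insert.hyps by (simp add: mult_ac)
  moreover have "zorder h' v = zorder g v" if "v \<notin> insert w Z" for v
    using that h'(4)[of v] h(4)[of v] by simp
  ultimately show ?case using h'(1) by blast
qed

text \<open>Only finitely many Taylor coefficients survive in the limit, so refining the subsequence
  once per index is enough and no diagonal argument enters.\<close>

lemma bounded_sequences_common_subseq:
  fixes c :: "nat \<Rightarrow> nat \<Rightarrow> complex"
  assumes "\<And>k. k < n \<Longrightarrow> bounded (range (c k))"
  shows "\<exists>r l. strict_mono r \<and> (\<forall>k<n. (\<lambda>i. c k (r i)) \<longlonglongrightarrow> l k)"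
  using assms
proof (induction n)
  case 0
  then show ?case using strict_mono_id by auto
next
  case (Suc n)
  then obtain r l where r: "strict_mono r" "\<And>k. k < n \<Longrightarrow> (\<lambda>i. c k (r i)) \<longlonglongrightarrow> l k"
    by (metis less_SucI)
  have "bounded (range (\<lambda>i. c n (r i)))"
    by (rule bounded_subset[OF Suc.prems[of n]]) auto
  from bounded_imp_convergent_subsequence[OF this] obtain q x where q: "strict_mono q" "((\<lambda>i. c n (r i)) \<circ> q) \<longlonglongrightarrow> x"
    by blast
  have "(\<lambda>i. c k ((r \<circ> q) i)) \<longlonglongrightarrow> (l(n := x)) k" if "k < Suc n" for k
    using that q LIMSEQ_subseq_LIMSEQ[OF r(2) q(1), of k] by (cases "k = n") (auto simp: o_def)
  then show ?case using strict_mono_o[OF r(1) q(1)] by blast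
qed

lemma entire_finite_zeros_cball:
  assumes F: "F holomorphic_on UNIV" and "F z0 \<noteq> 0"
  shows "finite {w \<in> cball 0 R. F w = 0}"
proof (cases "F constant_on UNIV")
  case True
  then have "F w \<noteq> 0" for w using assms(2) by (metis UNIV_I constant_on_def)
  then show ?thesis by simp
next
  case False
  then show ?thesis using holomorphic_compact_finite_zeros[OF F, of "cball 0 R"] by auto
qed

lemma entire_zorder_pos_iff:
  assumes F: "F holomorphic_on UNIV" and "F z0 \<noteq> 0"
  shows "zorder F w > 0 \<longleftrightarrow> F w = 0"
proof -
  have "eventually (\<lambda>z. F z \<noteq> 0) (at w)"
    using non_zero_neighbour_alt[OF F, of w z0] assms(2) by (auto elim: eventually_mono)
  then show ?thesis
    by (intro zorder_pos_iff[OF F]) (auto intro: eventually_frequently)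
qed

text \<open>
  \<open>F\<close> is divided by the canonical product \<open>P\<close> over its zeros in \<open>cball 0 N\<close>. To bound the
  quotient from above without estimating \<open>P\<close> from below, one divides by \<open>\<Prod>(1 - z/w)\<close> first: on
  the circle of radius \<open>2 N\<close> all these factors have modulus at least 1.
\<close>
lemma entire_quotient_finite_stage:
  fixes s :: real
  assumes F: "F holomorphic_on UNIV" and F0: "F 0 = 1"
    and growth: "\<And>z. norm (F z) \<le> K * exp (norm z ^ A)"
    and s: "s > 0"
    and summ: "(\<lambda>w. of_int (zorder F w) * norm w powr (-s)) summable_on {w. F w = 0}"
  shows "\<exists>C\<ge>0. \<exists>B>0. \<exists>D. \<forall>N\<ge>1. \<exists>L. L holomorphic_on ball 0 (real N) \<and> L 0 = 0 \<and>
     (\<forall>z\<in>ball 0 (real N). Re (L z) \<le> B * real N ^ D \<and> norm (F z * exp (- L z)) \<le> exp (C * norm z powr s))"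
proof -
  \<comment> \<open>The integer with p < s <= p + 1, as the estimate of the Weierstrass factor
    demands; for integral \<open>s\<close> it is s - 1.\<close>
  define p where "p = nat \<lceil>s\<rceil> - 1"
  have p: "real p < s" "s \<le> real p + 1"
    using s unfolding p_def by linarith+
  obtain C where C: "C \<ge> 0" "\<And>u. norm (weierstrass_factor p u) \<le> exp (C * norm u powr s)"
    using norm_weierstrass_factor_le[OF p] by blast
  define Z where "Z = (\<lambda>N::nat. {w \<in> cball 0 (real N). F w = 0})"
  define k where "k = (\<lambda>w. nat (zorder F w))"
  define S where "S = infsum (\<lambda>w. of_int (zorder F w) * norm w powr (-s)) {w. F w = 0}"
  have F0': "F 0 \<noteq> 0" using F0 by simp
  have fin: "finite (Z N)" for N
    unfolding Z_def by (rule entire_finite_zeros_cball[OF F F0'])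
  have k: "real (k w) = of_int (zorder F w)" "k w > 0" if "F w = 0" for w
    using entire_zorder_pos_iff[OF F F0', of w] that by (auto simp: k_def)
  have w0: "w \<noteq> 0" if "w \<in> Z N" for w N
    using that F0 by (auto simp: Z_def)
  have S_le: "(\<Sum>w\<in>Z N. real (k w) * norm w powr (-s)) \<le> S" for N
  proof -
    have "(\<Sum>w\<in>Z N. real (k w) * norm w powr (-s)) = (\<Sum>w\<in>Z N. of_int (zorder F w) * norm w powr (-s))"
      by (intro sum.cong refl) (auto simp: Z_def k)
    also have "\<dots> \<le> S"
      unfolding S_def
      by (rule finite_sum_le_infsum[OF summ fin]) (auto simp: Z_def dest: k(1)[symmetric])
    finally show ?thesis .
  qed
  have S0: "S \<ge> 0" using S_le[of 0] by (rule order_trans[rotated]) (auto intro!: sum_nonneg)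
  have K: "K > 0"
  proof (rule ccontr)
    assume "\<not> K > 0"
    then have "K * exp (norm (0::complex) ^ A) \<le> 0" by (simp add: mult_nonpos_nonneg)
    then show False using growth[of 0] F0 by simp
  qed
  define P where "P = (\<lambda>N z. \<Prod>w\<in>Z N. weierstrass_factor p (z / w) ^ k w)"
  \<comment> \<open>\<open>V\<close> collects the exponents of the Weierstrass factors:
    \<open>P\<close> is the product of the (1 - z/w)^k times exp \<open>V\<close>. Thus F / P
    becomes H exp (- V), whose two factors are bounded separately.\<close>
  define V where "V = (\<lambda>N z. \<Sum>w\<in>Z N. of_nat (k w) * (\<Sum>j=1..p. (z / w) ^ j / of_nat j))"
  have P_bound: "norm (P N z) \<le> exp (C * S * norm z powr s)" for N z
  proof -
    have "norm (P N z) \<le> (\<Prod>w\<in>Z N. exp (C * norm z powr s * (real (k w) * norm w powr (-s))))"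
      unfolding P_def prod_norm[symmetric]
    proof (rule prod_mono, safe)
      fix w assume w: "w \<in> Z N"
      have "norm (weierstrass_factor p (z / w) ^ k w) \<le> exp (C * norm (z / w) powr s) ^ k w"
        unfolding norm_power by (intro power_mono C) auto
      also have "\<dots> = exp (C * norm z powr s * (real (k w) * norm w powr (-s)))"
        using w0[OF w] by (simp add: norm_divide powr_divide powr_minus exp_of_nat_mult[symmetric] field_simps)
      finally show "norm (weierstrass_factor p (z / w) ^ k w) \<le> exp (C * norm z powr s * (real (k w) * norm w powr (-s)))" .
    qed auto
    also have "\<dots> = exp (C * norm z powr s * (\<Sum>w\<in>Z N. real (k w) * norm w powr (-s)))"
      by (simp add: exp_sum[OF fin] sum_distrib_left)
    also have "\<dots> \<le> exp (C * norm z powr s * S)"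
      using C(1) S_le[of N] by (simp add: mult_left_mono)
    finally show ?thesis by (simp add: mult_ac)
  qed
  have V_bound: "norm (V N z) \<le> real p * real N powr s * S" if "norm z \<le> real N" for N z
  proof -
    have "norm (V N z) \<le> (\<Sum>w\<in>Z N. real (k w) * (real p * (real N powr s * norm w powr (-s))))"
      unfolding V_def
    proof (rule order_trans[OF norm_sum], rule sum_mono)
      fix w assume w: "w \<in> Z N"
      then have nw: "norm w > 0" "norm w \<le> real N" using w0[OF w] by (auto simp: Z_def)
      have "norm (\<Sum>j=1..p. (z / w) ^ j / of_nat j) \<le> (\<Sum>j=1..p. real N powr s * norm w powr (-s))"
      proof (rule order_trans[OF norm_sum], rule sum_mono)
        fix j assume j: "j \<in> {1..p}"
        have "norm ((z / w) ^ j / of_nat j) \<le> norm (z / w) ^ j / 1"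
          using j unfolding norm_divide norm_power by (intro divide_left_mono) auto
        also have "\<dots> \<le> (real N / norm w) ^ j / 1"
          using that nw by (intro divide_right_mono power_mono) (auto simp: norm_divide divide_right_mono)
        also have "\<dots> = (real N / norm w) powr real j"
          using nw by (subst powr_realpow) (auto intro!: divide_pos_pos less_le_trans[OF nw])
        \<comment> \<open>Zeros in \<open>Z N\<close> satisfy |w| <= N, so the base is at least 1
          and every exponent j <= p may be raised to \<open>s\<close>. The sum over the zeros is
          then controlled by \<open>S\<close>.\<close>
        also have "\<dots> \<le> (real N / norm w) powr s"
          using nw j p by (intro powr_mono) auto
        also have "\<dots> = real N powr s * norm w powr (-s)"
          using nw by (simp add: powr_divide powr_minus_divide)
        finally show "norm ((z / w) ^ j / of_nat j) \<le> real N powr s * norm w powr (-s)" .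
      qed
      then show "norm (of_nat (k w) * (\<Sum>j=1..p. (z / w) ^ j / of_nat j)) \<le> real (k w) * (real p * (real N powr s * norm w powr (-s)))"
        by (simp add: norm_mult mult_left_mono)
    qed
    also have "\<dots> = real p * real N powr s * (\<Sum>w\<in>Z N. real (k w) * norm w powr (-s))"
      by (simp add: sum_distrib_left mult_ac)
    also have "\<dots> \<le> real p * real N powr s * S"
      using S_le[of N] by (intro mult_left_mono) auto
    finally show ?thesis .
  qed
  \<comment> \<open>N^D dominates N^A, coming from the growth of \<open>F\<close> on |z| = 2 N, and
    N^s, coming from \<open>V\<close>, since s <= p + 1. The factor 2^A in \<open>B\<close> is due
    to the radius 2 N.\<close>
  define D where "D = A + p + 1"
  define B where "B = 2 ^ A + real p * S + \<bar>ln K\<bar>"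
  have B: "B > 0" using S0 by (simp add: B_def add_pos_nonneg)
  have stage: "\<exists>L. L holomorphic_on ball 0 (real N) \<and> L 0 = 0 \<and>
     (\<forall>z\<in>ball 0 (real N). Re (L z) \<le> B * real N ^ D \<and> norm (F z * exp (- L z)) \<le> exp (C * S * norm z powr s))"
    if N: "N \<ge> 1" for N
  proof -
    obtain h where h: "h holomorphic_on UNIV" "\<And>w. w \<in> Z N \<Longrightarrow> h w \<noteq> 0"
      "\<And>z. F z = (\<Prod>w\<in>Z N. (z - w) ^ k w) * h z"
      using entire_zeros_factor[OF F _ fin[of N]] F0' unfolding k_def by blast
    define H where "H = (\<lambda>z. (\<Prod>w\<in>Z N. (- w) ^ k w) * h z)"
    have holH: "H holomorphic_on X" for X
      unfolding H_def by (intro holomorphic_intros holomorphic_on_subset[OF h(1)]) auto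
    have F_H: "F z = (\<Prod>w\<in>Z N. (1 - z / w) ^ k w) * H z" for z
    proof -
      have "(\<Prod>w\<in>Z N. (z - w) ^ k w) = (\<Prod>w\<in>Z N. (1 - z / w) ^ k w * (- w) ^ k w)"
        using w0 by (intro prod.cong refl) (simp add: power_mult_distrib[symmetric] field_simps)
      then show ?thesis by (simp add: h(3)[of z] H_def prod.distrib)
    qed
    have H_bound: "norm (H z) \<le> K * exp ((2 * real N) ^ A)" if "norm z \<le> 2 * real N" for z
    proof (rule maximum_modulus_frontier[of H "cball 0 (2 * real N)"])
      fix z :: complex assume "z \<in> frontier (cball 0 (2 * real N))"
      then have z: "norm z = 2 * real N" using N by simp
      have "1 \<le> (\<Prod>w\<in>Z N. norm (1 - z / w) ^ k w)"
      proof (rule prod_ge_1)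
        fix w assume w: "w \<in> Z N"
        have "2 * norm w \<le> norm z" using w z by (simp add: Z_def)
        then have "2 \<le> norm (z / w)" using w0[OF w] by (simp add: norm_divide field_simps)
        then have "1 \<le> norm (1 - z / w)" using norm_triangle_ineq2[of "z / w" 1] by (simp add: norm_minus_commute)
        then show "1 \<le> norm (1 - z / w) ^ k w" by simp
      qed
      from mult_right_mono[OF this norm_ge_zero[of "H z"]] have "norm (H z) \<le> norm (F z)"
        by (simp add: F_H norm_mult prod_norm[symmetric] norm_power)
      then show "norm (H z) \<le> K * exp ((2 * real N) ^ A)" using growth[of z] z by simp
    qed (use that holH in \<open>auto intro: holomorphic_on_imp_continuous_on\<close>)
    define U where "U = (\<lambda>z. H z * exp (- V N z))"
    have F_U: "F z = P N z * U z" for z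
    proof -
      have "P N z = (\<Prod>w\<in>Z N. (1 - z / w) ^ k w) * exp (V N z)"
        unfolding P_def V_def weierstrass_factor_def
        by (simp add: power_mult_distrib prod.distrib exp_sum[OF fin] exp_of_nat_mult[symmetric])
      then show ?thesis by (simp add: F_H U_def exp_minus)
    qed
    have holU: "U holomorphic_on X" for X
      unfolding U_def V_def by (intro holomorphic_intros holH) (auto dest: w0)
    \<comment> \<open>A zero of \<open>U\<close> in the disc would be a zero of \<open>h\<close> and
      of \<open>F\<close>, hence a point of \<open>Z N\<close>, where \<open>h\<close> does not
      vanish. This gives \<open>U\<close> a holomorphic logarithm on the disc.\<close>
    have U_nz: "U z \<noteq> 0" if "z \<in> ball 0 (real N)" for z
    proof
      assume "U z = 0"
      then have "h z = 0" "F z = 0" using w0 fin by (auto simp: F_U U_def H_def)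
      then show False using h(2)[of z] that by (auto simp: Z_def)
    qed
    have U0: "U 0 = 1" using F_U[of 0] F0 by (simp add: P_def)
    have U_bound: "norm (U z) \<le> exp (B * real N ^ D)" if "norm z \<le> real N" for z
    proof -
      have "norm (U z) \<le> (K * exp ((2 * real N) ^ A)) * exp (real p * real N powr s * S)"
        unfolding U_def norm_mult
        using H_bound[of z] that V_bound[OF that] norm_exp[of "- V N z"] K
        by (intro mult_mono) (auto intro: order_trans)
      also have "K = exp (ln K)" using K by simp
      also have "exp (ln K) * exp ((2 * real N) ^ A) * exp (real p * real N powr s * S)
          = exp (ln K + 2 ^ A * real N ^ A + real p * S * real N powr s)"
        by (simp add: exp_add power_mult_distrib mult_ac)
      also have "\<dots> \<le> exp (\<bar>ln K\<bar> * real N ^ D + 2 ^ A * real N ^ D + real p * S * real N ^ D)"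
      proof -
        have "real N powr s \<le> real N powr (real D)"
          using N p by (intro powr_mono) (auto simp: D_def)
        also have "\<dots> = real N ^ D" using N by (intro powr_realpow) auto
        finally have 1: "real N powr s \<le> real N ^ D" .
        have 2: "real N ^ A \<le> real N ^ D" using N by (intro power_increasing) (auto simp: D_def)
        have 3: "1 \<le> real N ^ D" using N by simp
        have "ln K \<le> \<bar>ln K\<bar> * 1" by simp
        also have "\<dots> \<le> \<bar>ln K\<bar> * real N ^ D" using 3 by (intro mult_left_mono) auto
        finally have "ln K \<le> \<bar>ln K\<bar> * real N ^ D" .
        then show ?thesis using 1 2 S0 by (auto intro!: add_mono mult_left_mono)
      qed
      also have "\<bar>ln K\<bar> * real N ^ D + 2 ^ A * real N ^ D + real p * S * real N ^ D = B * real N ^ D"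
        by (simp add: B_def algebra_simps)
      finally show ?thesis .
    qed
    obtain L where L: "L holomorphic_on ball 0 (real N)" "\<And>z. z \<in> ball 0 (real N) \<Longrightarrow> U z = exp (L z)"
      using contractible_imp_holomorphic_log[OF holU[of "ball 0 (real N)"]] U_nz
      by (metis convex_ball convex_imp_contractible)
    have L0: "exp (L 0) = 1" using L(2)[of 0] U0 N by simp
    \<comment> \<open>\<open>exp (L 0) = 1\<close> determines \<open>L 0\<close> only up to
      multiples of 2 pi i; the shift provides the value 0 at the origin that Borel-Caratheodory
      requires.\<close>
    define L' where "L' = (\<lambda>z. L z - L 0)"
    have L': "exp (L' z) = U z" if "z \<in> ball 0 (real N)" for z
      using L(2)[OF that] L0 by (simp add: L'_def exp_diff)
    show ?thesis
    proof (intro exI[of _ L'] conjI ballI)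
      show "L' holomorphic_on ball 0 (real N)"
        unfolding L'_def by (intro holomorphic_intros L)
      fix z :: complex assume z: "z \<in> ball 0 (real N)"
      have "exp (Re (L' z)) = norm (U z)" by (simp flip: L'[OF z])
      then have "exp (Re (L' z)) \<le> exp (B * real N ^ D)"
        using U_bound[of z] z by simp
      then show "Re (L' z) \<le> B * real N ^ D" by simp
      have "F z * exp (- L' z) = P N z"
        using F_U[of z] L'[OF z] U_nz[OF z] by (simp add: exp_minus)
      then show "norm (F z * exp (- L' z)) \<le> exp (C * S * norm z powr s)"
        using P_bound[of N z] by simp
    qed (simp add: L'_def)
  qed
  show ?thesis using stage B C(1) S0 by (intro exI[of _ "C * S"] conjI exI[of _ B] exI[of _ D]) auto
qed

text \<open>
  The upper bound for \<open>Re L\<close> forces the Taylor coefficients of \<open>L\<close> of index above \<open>D\<close> to tend to 0 as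
  \<open>N \<longrightarrow> \<infinity>\<close>. Near 0, where \<open>F\<close> has no zeros, \<open>Re L\<close> is bounded below, so the remaining coefficients stay
  bounded and converge along a subsequence to those of \<open>Q\<close>.
\<close>
lemma hadamard_bound:
  fixes s :: real
  assumes F: "F holomorphic_on UNIV" and F0: "F 0 = 1"
    and growth: "\<And>z. norm (F z) \<le> K * exp (norm z ^ A)"
    and s: "s > 0"
    and summ: "(\<lambda>w. of_int (zorder F w) * norm w powr (-s)) summable_on {w. F w = 0}"
  obtains C and Q :: "complex poly"
    where "C \<ge> 0" "\<forall>z. norm (F z * exp (- poly Q z)) \<le> exp (C * norm z powr s)"
proof -
  obtain C B D L where C: "C \<ge> 0" and B: "B > 0" and
    L: "\<And>N. N \<ge> 1 \<Longrightarrow> L N holomorphic_on ball 0 (real N)" "\<And>N. N \<ge> 1 \<Longrightarrow> L N 0 = 0"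
      "\<And>N z. N \<ge> 1 \<Longrightarrow> z \<in> ball 0 (real N) \<Longrightarrow> Re (L N z) \<le> B * real N ^ D"
      "\<And>N z. N \<ge> 1 \<Longrightarrow> z \<in> ball 0 (real N) \<Longrightarrow> norm (F z * exp (- L N z)) \<le> exp (C * norm z powr s)"
    using entire_quotient_finite_stage[OF assms] by metis
  define c where "c = (\<lambda>k N. (deriv ^^ k) (L N) 0 / fact k)"
  have c_high: "norm (c k N) \<le> 2 * (B * real N ^ D) / (real N / 2) ^ k" if "N \<ge> 1" for k N
    unfolding c_def using L(1-3)[OF that] that B by (intro holomorphic_coeff_bound) auto
  have "isCont F 0" using F by (metis UNIV_I continuous_on_eq_continuous_at holomorphic_on_imp_continuous_on open_UNIV)
  from this[unfolded continuous_at_eps_delta, rule_format, of "1 / 2"]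
  obtain e where e: "e > 0" "\<And>z. norm z < e \<Longrightarrow> norm (F z - 1) < 1 / 2"
    by (auto simp: dist_norm F0)
  define r where "r = min e 1"
  have r: "r > 0" "r \<le> 1" "\<And>z. norm z < r \<Longrightarrow> norm (F z) \<ge> 1 / 2"
  proof -
    fix z :: complex assume "norm z < r"
    then have "norm (F z - 1) < 1 / 2" using e by (simp add: r_def)
    then show "norm (F z) \<ge> 1 / 2" using norm_triangle_ineq2[of 1 "1 - F z"] by (simp add: norm_minus_commute)
  qed (use e in \<open>auto simp: r_def\<close>)
  have c_low: "norm (c k N) \<le> 2 * (C + 1) / (r / 2) ^ k" if N: "N \<ge> 1" for k N
  proof -
    have sub: "ball 0 r \<subseteq> ball (0::complex) (real N)" using r N by (intro subset_ball) linarith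
    have hol: "(\<lambda>z. - L N z) holomorphic_on ball 0 r"
      using holomorphic_on_subset[OF L(1)[OF N] sub] by (intro holomorphic_intros)
    have "norm ((deriv ^^ k) (\<lambda>z. - L N z) 0 / fact k) \<le> 2 * (C + 1) / (r / 2) ^ k"
    proof (rule holomorphic_coeff_bound[OF hol])
      fix z :: complex assume z: "z \<in> ball 0 r"
      \<comment> \<open>Since r <= 1, the growth bound is at most exp C; the factor 2 lost through
        |F| >= 1/2 is absorbed by e, whence C + 1.\<close>
      have "(1 / 2) * exp (- Re (L N z)) \<le> norm (F z) * exp (- Re (L N z))"
        using r(3)[of z] z by (intro mult_right_mono) auto
      also have "\<dots> = norm (F z * exp (- L N z))" by (simp add: norm_mult)
      also have "\<dots> \<le> exp (C * norm z powr s)" using L(4)[OF N, of z] z sub by blast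
      also have "\<dots> \<le> exp (C * 1)"
        using C z r s powr_mono2[of s "norm z" 1] mult_left_mono[of "norm z powr s" 1 C] by auto
      finally have "exp (- Re (L N z)) \<le> 2 * exp C" by simp
      also have "2 * exp C \<le> exp 1 * exp C" using exp_ge_add_one_self[of 1] by (intro mult_right_mono) auto
      finally show "Re (- L N z) \<le> C + 1" by (simp add: exp_add[symmetric] add.commute)
    qed (use r C L(2)[OF N] in auto)
    moreover have "(deriv ^^ k) (\<lambda>z. - L N z) 0 = - (deriv ^^ k) (L N) 0"
      using r holomorphic_on_subset[OF L(1)[OF N] sub] by (intro higher_deriv_uminus[of _ "ball 0 r"]) auto
    ultimately show ?thesis by (simp add: c_def)
  qed
  \<comment> \<open>The index is shifted because the bounds hold only from N = 1 on.\<close>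
  have "bounded (range (\<lambda>N. c k (Suc N)))" for k
    using c_low[of "Suc _" k] by (auto intro!: boundedI)
  from bounded_sequences_common_subseq[of "Suc D" "\<lambda>k N. c k (Suc N)", OF this] obtain q l
    where q: "strict_mono q" "\<And>k. k \<le> D \<Longrightarrow> (\<lambda>i. c k (Suc (q i))) \<longlonglongrightarrow> l k"
    by (auto simp: less_Suc_eq_le)
  define Q where "Q = (\<Sum>k\<le>D. monom (l k) k)"
  have Q: "poly Q z = (\<Sum>k\<le>D. l k * z ^ k)" for z
    by (simp add: Q_def poly_sum poly_monom)
  \<comment> \<open>For k > D the coefficient bound gives terms 2 B N^D x^k with x = 2 |z| / N. The
    geometric sum is led by k = D + 1, where N^D x^(D+1) = (2 |z|)^(D+1) / N; this spare 1 / N kills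
    the tail.\<close>
  have tail: "norm (L N z - (\<Sum>k\<le>D. c k N * z ^ k)) \<le> 4 * B * (2 * norm z) ^ Suc D / real N"
    if N: "N \<ge> 1" "4 * norm z \<le> real N" for N z
  proof -
    define x where "x = 2 * norm z / real N"
    have x: "0 \<le> x" "x \<le> 1 / 2" using N by (auto simp: x_def field_simps)
    have "norm z < real N" using N by (cases "z = 0") (auto intro: less_le_trans[of _ "4 * norm z"])
    then have "(\<lambda>k. c k N * z ^ k) sums L N z"
      using holomorphic_power_series[OF L(1)[OF N(1)], of z] by (simp add: c_def)
    then have s1: "(\<lambda>i. c (i + Suc D) N * z ^ (i + Suc D)) sums (L N z - (\<Sum>k\<le>D. c k N * z ^ k))"
      using sums_split_initial_segment[of _ _ "Suc D"] by (simp only: lessThan_Suc_atMost)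
    have s2: "(\<lambda>i. (2 * B * real N ^ D * x ^ Suc D) * x ^ i) sums ((2 * B * real N ^ D * x ^ Suc D) * (1 / (1 - x)))"
      using x by (intro sums_mult geometric_sums) auto
    have "norm (L N z - (\<Sum>k\<le>D. c k N * z ^ k)) \<le> (2 * B * real N ^ D * x ^ Suc D) * (1 / (1 - x))"
    proof (rule norm_sums_le[OF s1 s2])
      fix i
      have "norm (c (i + Suc D) N * z ^ (i + Suc D)) \<le> 2 * (B * real N ^ D) / (real N / 2) ^ (i + Suc D) * norm z ^ (i + Suc D)"
        unfolding norm_mult norm_power by (intro mult_right_mono c_high N) auto
      also have "\<dots> = 2 * B * real N ^ D * x ^ (i + Suc D)"
        by (simp add: x_def power_divide power_mult_distrib)
      finally show "norm (c (i + Suc D) N * z ^ (i + Suc D)) \<le> (2 * B * real N ^ D * x ^ Suc D) * x ^ i"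
        by (simp add: power_add mult_ac)
    qed
    also have "\<dots> \<le> (2 * B * real N ^ D * x ^ Suc D) * 2"
      using x B by (intro mult_left_mono) (auto simp: field_simps)
    also have "\<dots> = 4 * B * (2 * norm z) ^ Suc D / real N"
      using N by (simp add: x_def power_divide field_simps)
    finally show ?thesis .
  qed
  have qlim: "filterlim (\<lambda>i. real (Suc (q i))) at_top sequentially"
    by (intro filterlim_compose[OF filterlim_real_sequentially] filterlim_compose[OF filterlim_Suc] filterlim_subseq q)
  have L_lim: "(\<lambda>i. L (Suc (q i)) z) \<longlonglongrightarrow> poly Q z" for z
  proof -
    have "(\<lambda>i. L (Suc (q i)) z - (\<Sum>k\<le>D. c k (Suc (q i)) * z ^ k)) \<longlonglongrightarrow> 0"
    proof (rule Lim_null_comparison)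
      show "eventually (\<lambda>i. norm (L (Suc (q i)) z - (\<Sum>k\<le>D. c k (Suc (q i)) * z ^ k))
          \<le> 4 * B * (2 * norm z) ^ Suc D / real (Suc (q i))) sequentially"
        using filterlim_at_top[THEN iffD1, OF qlim, rule_format, of "4 * norm z"]
        by eventually_elim (rule tail; simp)
      show "(\<lambda>i. 4 * B * (2 * norm z) ^ Suc D / real (Suc (q i))) \<longlonglongrightarrow> 0"
        by (rule tendsto_divide_0[OF tendsto_const filterlim_at_top_imp_at_infinity[OF qlim]])
    qed
    moreover have "(\<lambda>i. \<Sum>k\<le>D. c k (Suc (q i)) * z ^ k) \<longlonglongrightarrow> poly Q z"
      unfolding Q by (intro tendsto_intros q(2)) auto
    ultimately show ?thesis by (rule Lim_transform[rotated])
  qed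
  have "norm (F z * exp (- poly Q z)) \<le> exp (C * norm z powr s)" for z
  proof (rule tendsto_upperbound)
    show "(\<lambda>i. norm (F z * exp (- L (Suc (q i)) z))) \<longlonglongrightarrow> norm (F z * exp (- poly Q z))"
      by (intro tendsto_intros L_lim)
    show "eventually (\<lambda>i. norm (F z * exp (- L (Suc (q i)) z)) \<le> exp (C * norm z powr s)) sequentially"
      using filterlim_at_top_dense[THEN iffD1, OF qlim, rule_format, of "norm z"]
      by eventually_elim (rule L(4); simp)
  qed auto
  then show ?thesis using that[OF C] by blast
qed

subsection \<open>Regular growth from a Borel exceptional value\<close>

text \<open>
  Multiplying the \<open>n\<close> rotations of \<open>G\<close> by multiples of \<open>2\<pi>/n\<close>, every point of the circle has one
  of its rotations in the given arc; if \<open>G\<close> were tiny on the arc, the product would violate the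
  maximum modulus principle at 0.
\<close>
lemma entire_lower_bound_on_arc:
  fixes G :: "complex \<Rightarrow> complex"
  assumes G: "G holomorphic_on UNIV" "G 0 \<noteq> 0" and t: "t > 0" and n: "n > 0" and u: "norm u = 1"
    and M: "M \<ge> 0" "\<And>z. norm z = t \<Longrightarrow> norm (G z) \<le> exp M"
  shows "\<exists>\<theta>\<in>{0..2 * pi / real n}. norm (G (of_real t * u * cis \<theta>)) \<ge> norm (G 0) ^ n * exp (- (real n * M)) / 2"
proof (rule ccontr)
  assume neg: "\<not> ?thesis"
  \<comment> \<open>On the circle one factor of the product is at most \<open>E\<close> and the
    others at most exp M, so the product is at most |G 0|^n / 2, while at 0 it equals |G 0|^n. The
    factor 1/2 supplies the contradiction.\<close>
  define E where "E = norm (G 0) ^ n * exp (- (real n * M)) / 2"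
  have small: "norm (G (of_real t * u * cis \<theta>)) \<le> E" if "0 \<le> \<theta>" "\<theta> \<le> 2 * pi / real n" for \<theta>
    using neg that by (auto simp: E_def not_le intro: less_imp_le)
  define T where "T = (\<lambda>z. \<Prod>j=1..n. G (z * cis (2 * pi * real j / real n)))"
  have holT: "T holomorphic_on X" for X
    unfolding T_def
    by (intro holomorphic_intros holomorphic_on_compose_gen[OF _ G(1), unfolded o_def]) auto
  have "norm (T 0) \<le> norm (G 0) ^ n / 2"
  proof (rule maximum_modulus_frontier[of T "cball 0 t"])
    fix z :: complex assume "z \<in> frontier (cball 0 t)"
    then have z: "norm z = t" using t by simp
    define \<phi> where "\<phi> = Arg2pi (z / (of_real t * u))"
    have nz: "norm (z / (of_real t * u)) = 1" using z t u by (simp add: norm_divide norm_mult)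
    have \<phi>: "0 \<le> \<phi>" "\<phi> < 2 * pi" by (simp_all add: \<phi>_def Arg2pi_ge_0 Arg2pi_lt_2pi)
    have "z / (of_real t * u) = cis \<phi>"
      using Arg2pi_eq[of "z / (of_real t * u)"] nz by (simp add: \<phi>_def cis_conv_exp)
    moreover have "of_real t * u \<noteq> 0" using t u by auto
    ultimately have z_eq: "z = of_real t * u * cis \<phi>" by (simp add: field_simps)
    \<comment> \<open>\<open>m\<close> is the real number of steps of size 2 pi / n from the angle
      \<open>\<phi>\<close> up to 2 pi. Rounding up to \<open>j\<close> overshoots by less than one
      step, which puts the rotated point on the arc.\<close>
    define m where "m = (2 * pi - \<phi>) * real n / (2 * pi)"
    have m: "m > 0" "m \<le> real n" using \<phi> n by (auto simp: m_def field_simps)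
    define j where "j = nat \<lceil>m\<rceil>"
    have j: "j \<in> {1..n}" "real j \<ge> m" "real j < m + 1" using m unfolding j_def by (auto; linarith)+
    define \<theta> where "\<theta> = 2 * pi * (real j - m) / real n"
    have \<theta>: "0 \<le> \<theta>" "\<theta> \<le> 2 * pi / real n"
      using j n mult_left_mono[of "real j - m" 1 "2 * pi"] by (auto simp: \<theta>_def intro!: divide_right_mono)
    have "\<phi> + 2 * pi * real j / real n = \<theta> + 2 * pi"
      using n by (simp add: \<theta>_def m_def field_simps)
    then have "cis \<phi> * cis (2 * pi * real j / real n) = cis (\<theta> + 2 * pi)"
      by (simp only: cis_mult)
    also have "\<dots> = cis \<theta> * cis (2 * pi)" by (simp only: cis_mult)
    finally have "cis \<phi> * cis (2 * pi * real j / real n) = cis \<theta>" by simp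
    then have *: "norm (G (z * cis (2 * pi * real j / real n))) \<le> E"
      using small[OF \<theta>] by (simp add: z_eq mult.assoc)
    have "norm (T z) = (\<Prod>i=1..n. norm (G (z * cis (2 * pi * real i / real n))))"
      by (simp add: T_def prod_norm)
    also have "\<dots> = norm (G (z * cis (2 * pi * real j / real n))) * (\<Prod>i\<in>{1..n} - {j}. norm (G (z * cis (2 * pi * real i / real n))))"
      using j(1) by (intro prod.remove) auto
    also have "\<dots> \<le> E * (\<Prod>i\<in>{1..n} - {j}. exp M)"
      using M(2) z * by (intro mult_mono prod_mono) (auto simp: norm_mult E_def prod_nonneg)
    also have "(\<Prod>i\<in>{1..n} - {j}. exp M) = exp M ^ (n - 1)"
      using j(1) by simp
    also have "E * exp M ^ (n - 1) \<le> E * exp M ^ n"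
      using M(1) by (intro mult_left_mono power_increasing) (auto simp: E_def)
    also have "\<dots> = E * exp (real n * M)" by (simp add: exp_of_nat_mult)
    also have "\<dots> = norm (G 0) ^ n / 2" by (simp add: E_def exp_minus)
    finally show "norm (T z) \<le> norm (G 0) ^ n / 2" .
  qed (use t holT in \<open>auto intro: holomorphic_on_imp_continuous_on\<close>)
  moreover have "norm (T 0) = norm (G 0) ^ n" by (simp add: T_def norm_power)
  moreover have "norm (G 0) ^ n > 0" using G(2) by simp
  ultimately show False by linarith
qed

section \<open>Maximum modulus and growth of entire series in \<open>class_K\<close>\<close>

lemma eval_complex_basics:
  assumes f: "f \<in> class_K" "entire_fps f"
  shows "eval_complex f holomorphic_on X"
    and "eval_complex f (of_real t) = of_real (eval_fps f t)"
    and "norm (eval_complex f z) \<le> eval_fps f (norm z)"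
proof -
  define h :: "complex fps" where "h = Abs_fps (\<lambda>n. of_real (fps_nth f n))"
  have cv: "fps_conv_radius f = \<infinity>" using f by (simp add: entire_fps_def)
  have "fps_conv_radius h = fps_conv_radius f"
    by (simp add: fps_conv_radius_def conv_radius_def h_def)
  then have cvh: "fps_conv_radius h = \<infinity>" using cv by simp
  have eq: "eval_complex f = eval_fps h" by (rule ext) (simp add: eval_complex_def h_def)
  show "eval_complex f holomorphic_on X"
    unfolding eq by (rule holomorphic_on_eval_fps) (simp add: cvh)
  have s: "(\<lambda>n. fps_nth f n * x ^ n) sums eval_fps f x" for x
    using sums_eval_fps[of x f] cv by simp
  have sh: "(\<lambda>n. fps_nth h n * x ^ n) sums eval_fps h x" for x
    using sums_eval_fps[of x h] cvh by simp
  show "eval_complex f (of_real t) = of_real (eval_fps f t)"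
    using sums_unique2[OF sh[of "of_real t"]] sums_of_real[OF s[of t], where ?'a = complex]
    by (simp add: eq h_def)
  show "norm (eval_complex f z) \<le> eval_fps f (norm z)"
    unfolding eq
    by (rule norm_sums_le[OF sh s]) (use f in \<open>auto simp: h_def norm_mult norm_power class_K_def\<close>)
qed

lemma class_K_at_top:
  assumes f: "f \<in> class_K" "entire_fps f"
  shows "filterlim (eval_fps f) at_top at_top"
proof -
  have cv: "fps_conv_radius f = \<infinity>" using f by (simp add: entire_fps_def)
  have nn: "fps_nth f n \<ge> 0" for n using f by (auto simp: class_K_def)
  obtain n where n: "n > 0" "fps_nth f n \<noteq> 0" using f by (auto simp: class_K_def)
  then have n': "fps_nth f n > 0" using nn[of n] by simp
  have "filterlim (\<lambda>t. fps_nth f n * t ^ n) at_top at_top"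
    using n n' by (intro filterlim_tendsto_pos_mult_at_top[OF tendsto_const] filterlim_pow_at_top filterlim_ident)
  then show ?thesis
    by (rule filterlim_at_top_mono)
       (use eval_fps_pos(1)[OF cv nn n'] in \<open>auto intro!: eventually_mono[OF eventually_gt_at_top[of 0]]\<close>)
qed

lemma finite_order_bound:
  assumes f: "f \<in> class_K" "entire_fps f" and fin: "growth_order f < \<infinity>"
  obtains A :: nat and K where "K > 0" "\<And>t. t \<ge> 0 \<Longrightarrow> eval_fps f t \<le> K * exp (t ^ A)"
proof -
  obtain A :: nat where A: "growth_order f < ereal (real A)"
    using fin less_PInf_Ex_of_nat[of "growth_order f"] by auto
  have "eventually (\<lambda>t. ereal (ln (ln (eval_fps f t)) / ln t) < ereal (real A)) at_top"
    using A unfolding growth_order_def by (rule Limsup_lessD)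
  moreover have "eventually (\<lambda>t. eval_fps f t > 1) at_top"
    using class_K_at_top[OF f] by (simp add: filterlim_at_top_dense)
  ultimately have "eventually (\<lambda>t. eval_fps f t \<le> exp (t ^ A)) at_top"
    using eventually_gt_at_top[of 1]
  proof eventually_elim
    case (elim t)
    have "ln (ln (eval_fps f t)) < real A * ln t" using elim by (simp add: field_simps)
    then have "exp (ln (ln (eval_fps f t))) < exp (real A * ln t)" by simp
    then have "ln (eval_fps f t) < t ^ A" using elim by (simp add: exp_of_nat_mult)
    then have "exp (ln (eval_fps f t)) \<le> exp (t ^ A)" by simp
    then show ?case using elim by simp
  qed
  then obtain t0 where t0: "\<And>t. t \<ge> t0 \<Longrightarrow> eval_fps f t \<le> exp (t ^ A)"
    by (auto simp: eventually_at_top_linorder)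
  have cont: "continuous_on {0..t0} (eval_fps f)"
    using f(2) by (intro continuous_on_subset[OF continuous_on_eval_fps]) (auto simp: entire_fps_def)
  have "bounded (eval_fps f ` {0..t0})"
    by (intro compact_imp_bounded compact_continuous_image cont) auto
  then obtain K where K: "K > 0" "\<And>t. t \<in> {0..t0} \<Longrightarrow> \<bar>eval_fps f t\<bar> \<le> K"
    unfolding bounded_pos by auto
  show ?thesis
  proof (rule that[of "max 1 K" A])
    fix t :: real assume t: "t \<ge> 0"
    show "eval_fps f t \<le> max 1 K * exp (t ^ A)"
    proof (cases "t \<le> t0")
      case True
      have "eval_fps f t \<le> max 1 K * 1" using K(2)[of t] t True by auto
      also have "\<dots> \<le> max 1 K * exp (t ^ A)" using t by (intro mult_left_mono) auto
      finally show ?thesis .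
    next
      case False
      then have "eval_fps f t \<le> 1 * exp (t ^ A)" using t0[of t] by simp
      also have "\<dots> \<le> max 1 K * exp (t ^ A)" by (intro mult_right_mono) auto
      finally show ?thesis .
    qed
  qed simp
qed

text \<open>Dividing f - a by z^m removes the zero at the origin, which the convergence exponent
  disregards, and allows the normalisation F 0 = 1. The growth bound survives: |z^m| >= 1 outside
  the unit disc, and the maximum modulus principle covers the inside.\<close>

lemma borel_exceptional_factorization:
  assumes f: "f \<in> class_K" "entire_fps f" and fin: "growth_order f < \<infinity>"
    and a: "borel_exceptional f a"
  obtains s C :: real and \<kappa> :: complex and G and m :: nat and Q :: "complex poly" where
    "s > 0" "ereal s < growth_order f" "C \<ge> 0" "\<kappa> \<noteq> 0" "G holomorphic_on UNIV" "G 0 \<noteq> 0"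
    "\<forall>z. norm (G z) \<le> exp (C * norm z powr s)"
    "\<forall>z. eval_complex f z - a = \<kappa> * z ^ m * exp (poly Q z) * G z"
proof -
  define g where "g = (\<lambda>z. eval_complex f z - a)"
  have holg: "g holomorphic_on X" for X
    unfolding g_def by (intro holomorphic_intros eval_complex_basics(1)[OF f])
  have "eventually (\<lambda>t. eval_fps f t > norm a) at_top"
    using class_K_at_top[OF f] by (simp add: filterlim_at_top_dense)
  then obtain t0 where "eval_fps f t0 > norm a"
    using eventually_happens'[OF trivial_limit_at_top_linorder] by blast
  then have nz: "g (of_real t0) \<noteq> 0"
    using abs_ge_self[of "eval_fps f t0"] by (auto simp: g_def eval_complex_basics(2)[OF f])
  obtain s where s: "s > 0" "ereal s < growth_order f"
    and summ: "(\<lambda>w. of_int (zorder g w) * norm w powr (-s)) summable_on {w. w \<noteq> 0 \<and> g w = 0}"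
    using a unfolding borel_exceptional_def convergence_exponent_def g_def Inf_less_iff by blast
  define m where "m = nat (zorder g 0)"
  obtain h where h: "h holomorphic_on UNIV" "h 0 \<noteq> 0" "\<And>z. g z = z ^ m * h z"
      "\<And>v. v \<noteq> 0 \<Longrightarrow> zorder h v = zorder g v"
    using entire_zero_factor[OF holg, of 0] nz unfolding m_def by auto
  obtain A K where K: "K > 0" "\<And>t. t \<ge> 0 \<Longrightarrow> eval_fps f t \<le> K * exp (t ^ A)"
    using finite_order_bound[OF f fin] by blast
  \<comment> \<open>The factor e is the value of exp (|z|^A) on the unit circle, from which the
    bound is carried into the disc.\<close>
  define K' where "K' = (K + norm a) * exp 1"
  have K': "K' > 0" using K by (simp add: K'_def add_pos_nonneg)
  have g_bound: "norm (g z) \<le> (K + norm a) * exp (norm z ^ A)" for z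
  proof -
    have "norm (g z) \<le> K * exp (norm z ^ A) + norm a * 1"
      using norm_triangle_ineq4[of "eval_complex f z" a] eval_complex_basics(3)[OF f, of z] K(2)[of "norm z"]
      by (simp add: g_def)
    also have "\<dots> \<le> K * exp (norm z ^ A) + norm a * exp (norm z ^ A)"
      by (intro add_left_mono mult_left_mono) auto
    finally show ?thesis by (simp add: algebra_simps)
  qed
  have h_out: "norm (h z) \<le> (K + norm a) * exp (norm z ^ A)" if "norm z \<ge> 1" for z
  proof -
    have "1 * norm (h z) \<le> norm z ^ m * norm (h z)" using that by (intro mult_right_mono) auto
    also have "\<dots> = norm (g z)" by (simp add: h norm_mult norm_power)
    finally show ?thesis using g_bound[of z] by simp
  qed
  have h_bound: "norm (h z) \<le> K' * exp (norm z ^ A)" for z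
  proof (cases "norm z \<ge> 1")
    case True
    have "(K + norm a) * exp (norm z ^ A) * 1 \<le> (K + norm a) * exp (norm z ^ A) * exp 1"
      using K by (intro mult_left_mono) auto
    then show ?thesis using h_out[OF True] by (simp add: K'_def mult_ac)
  next
    case False
    have "norm (h z) \<le> K'"
    proof (rule maximum_modulus_frontier[of h "cball 0 1"])
      show "norm (h w) \<le> K'" if "w \<in> frontier (cball 0 1)" for w
        using h_out[of w] that by (simp add: K'_def)
    qed (use False holomorphic_on_subset[OF h(1)] in \<open>auto intro: holomorphic_on_imp_continuous_on\<close>)
    also have "K' * 1 \<le> K' * exp (norm z ^ A)" using K' by (intro mult_left_mono) auto
    finally show ?thesis by simp
  qed
  define F where "F = (\<lambda>z. h z / h 0)"
  have holF: "F holomorphic_on UNIV" unfolding F_def using h by (intro holomorphic_intros) auto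
  have F0: "F 0 = 1" using h by (simp add: F_def)
  have F_bound: "norm (F z) \<le> (K' / norm (h 0)) * exp (norm z ^ A)" for z
    using h_bound[of z] h(2) by (simp add: F_def norm_divide field_simps)
  have zeros: "{w. F w = 0} = {w. w \<noteq> 0 \<and> g w = 0}"
    using h by (auto simp: F_def)
  have "zorder F w = zorder g w" if "w \<noteq> 0" for w
  proof -
    have "zorder (\<lambda>z. inverse (h 0) * h z) w = zorder h w"
      using h(2) by (intro zorder_cmult) auto
    then show ?thesis using h(4)[OF that] by (simp add: F_def[abs_def] field_simps)
  qed
  then have "(\<lambda>w. of_int (zorder F w) * norm w powr (-s)) summable_on {w. F w = 0}"
    using summ unfolding zeros
    by (subst summable_on_cong[where g = "\<lambda>w. of_int (zorder g w) * norm w powr (-s)"]) simp_all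
  from hadamard_bound[OF holF F0 F_bound s(1) this] obtain C Q where
    C: "C \<ge> 0" "\<forall>z. norm (F z * exp (- poly Q z)) \<le> exp (C * norm z powr s)" .
  show ?thesis
  proof (rule that[of s C "h 0" "\<lambda>z. F z * exp (- poly Q z)" m Q])
    show "(\<lambda>z. F z * exp (- poly Q z)) holomorphic_on UNIV" by (intro holomorphic_intros holF)
    show "\<forall>z. eval_complex f z - a = h 0 * z ^ m * exp (poly Q z) * (F z * exp (- poly Q z))"
      using h(2) h(3)[unfolded g_def] by (simp add: F_def exp_minus field_simps)
  qed (use s C h F0 in auto)
qed

text \<open>The constant is the sum of the moduli of the lower coefficients. In degree 0 this sum is
  empty and the truncated exponent is 0.\<close>

lemma poly_minus_lead_bound:
  fixes p :: "complex poly"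
  obtains W where "W \<ge> 0"
    "\<And>z. norm z \<ge> 1 \<Longrightarrow> norm (poly p z - lead_coeff p * z ^ degree p) \<le> W * norm z ^ (degree p - 1)"
proof (rule that[of "\<Sum>i<degree p. norm (coeff p i)"])
  fix z :: complex assume z: "norm z \<ge> 1"
  have "poly p z - lead_coeff p * z ^ degree p = (\<Sum>i<degree p. coeff p i * z ^ i)"
    by (simp add: poly_altdef lessThan_Suc_atMost[symmetric])
  also have "norm \<dots> \<le> (\<Sum>i<degree p. norm (coeff p i) * norm z ^ (degree p - 1))"
    using z by (intro order_trans[OF norm_sum] sum_mono)
      (auto simp: norm_mult norm_power intro!: mult_left_mono power_increasing)
  finally show "norm (poly p z - lead_coeff p * z ^ degree p) \<le> (\<Sum>i<degree p. norm (coeff p i)) * norm z ^ (degree p - 1)"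
    by (simp add: sum_distrib_right)
qed (auto intro: sum_nonneg)

text \<open>The constant \<open>W\<close> enters the order only through ln W / ln t, which tends to
  0.\<close>

lemma growth_order_le:
  assumes f: "f \<in> class_K" "entire_fps f" and W: "W > 0"
    and le: "eventually (\<lambda>t. ln (eval_fps f t) \<le> W * t powr s) at_top"
  shows "growth_order f \<le> ereal s"
proof -
  have "eventually (\<lambda>t. eval_fps f t > 1) at_top"
    using class_K_at_top[OF f] by (simp add: filterlim_at_top_dense)
  then have "eventually (\<lambda>t. ereal (ln (ln (eval_fps f t)) / ln t) \<le> ereal (ln W / ln t + s)) at_top"
    using le eventually_gt_at_top[of 1]
  proof eventually_elim
    case (elim t)
    have "ln (ln (eval_fps f t)) \<le> ln (W * t powr s)" using elim W by (intro ln_mono) auto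
    also have "\<dots> = ln W + s * ln t" using elim W by (simp add: ln_mult ln_powr)
    finally show ?case using elim by (simp add: field_simps)
  qed
  then have "growth_order f \<le> Limsup at_top (\<lambda>t. ereal (ln W / ln t + s))"
    unfolding growth_order_def by (rule Limsup_mono)
  also have "((\<lambda>t. ln W / ln t + s) \<longlongrightarrow> 0 + s) at_top"
    by (intro tendsto_add tendsto_divide_0[OF tendsto_const] tendsto_const filterlim_at_top_imp_at_infinity ln_at_top)
  then have "Limsup at_top (\<lambda>t. ereal (ln W / ln t + s)) = ereal s"
    by (intro lim_imp_Limsup) (auto intro: tendsto_ereal)
  finally show ?thesis .
qed

lemma borel_exceptional_regular_growth:
  assumes f: "f \<in> class_K" "entire_fps f" and fin: "growth_order f < \<infinity>"
    and a: "borel_exceptional f a"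
  obtains d :: nat and c :: real where "d > 0" "c > 0" "((\<lambda>t. ln (eval_fps f t) / t ^ d) \<longlongrightarrow> c) at_top"
proof -
  from borel_exceptional_factorization[OF f fin a]
  obtain s C \<kappa> G m Q where s: "s > 0" "ereal s < growth_order f" and C: "C \<ge> 0" and \<kappa>: "\<kappa> \<noteq> 0"
    and G: "G holomorphic_on UNIV" "G 0 \<noteq> 0" "\<forall>z. norm (G z) \<le> exp (C * norm z powr s)"
    and fact: "\<forall>z. eval_complex f z - a = \<kappa> * z ^ m * exp (poly Q z) * G z" .
  define F where "F = eval_fps f"
  define d where "d = degree Q"
  define b where "b = lead_coeff Q"
  obtain W where W: "W \<ge> 0" "\<And>z. norm z \<ge> 1 \<Longrightarrow> norm (poly Q z - b * z ^ d) \<le> W * norm z ^ (d - 1)"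
    using poly_minus_lead_bound[of Q] unfolding b_def d_def by blast
  have F_ge: "norm (eval_complex f z) \<le> F (norm z)" for z
    using eval_complex_basics(3)[OF f] by (simp add: F_def)
  have Re_Q: "\<bar>Re (poly Q z) - Re (b * z ^ d)\<bar> \<le> W * norm z ^ (d - 1)" if "norm z \<ge> 1" for z
    using W(2)[OF that] abs_Re_le_cmod[of "poly Q z - b * z ^ d"] by simp
  have F_large: "eventually (\<lambda>t. F t \<ge> 1) at_top"
    using class_K_at_top[OF f] by (simp add: filterlim_at_top F_def)
  define X where "X = (\<lambda>t. norm b * t ^ d + W * t ^ (d - 1) + C * t powr s)"
  define c0 where "c0 = ln (norm a + norm \<kappa>)"
  have upper: "eventually (\<lambda>t. ln (F t) \<le> c0 + real m * ln t + X t) at_top"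
    using F_large eventually_ge_at_top[of 1]
  proof eventually_elim
    case (elim t)
    have X: "X t \<ge> 0" using elim W(1) C by (simp add: X_def)
    have "F t = norm (eval_complex f (of_real t))"
      using elim by (simp add: eval_complex_basics(2)[OF f] F_def)
    also have "\<dots> \<le> norm (eval_complex f (of_real t) - a) + norm a"
      using norm_triangle_ineq[of "eval_complex f (of_real t) - a" a] by simp
    also have "norm (eval_complex f (of_real t) - a) = norm \<kappa> * t ^ m * (exp (Re (poly Q (of_real t))) * norm (G (of_real t)))"
      using elim by (simp add: fact[rule_format] norm_mult norm_power)
    also have "\<dots> \<le> norm \<kappa> * t ^ m * (exp (norm b * t ^ d + W * t ^ (d - 1)) * exp (C * t powr s))"
    proof (intro mult_left_mono mult_mono)
      have "Re (b * of_real t ^ d) \<le> norm (b * of_real t ^ d)" by (rule complex_Re_le_cmod)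
      also have "\<dots> = norm b * t ^ d" using elim by (simp add: norm_mult norm_power)
      finally show "exp (Re (poly Q (of_real t))) \<le> exp (norm b * t ^ d + W * t ^ (d - 1))"
        using Re_Q[of "of_real t"] elim by (simp del: Re_complex_of_real)
      show "norm (G (of_real t)) \<le> exp (C * t powr s)" using G(3)[rule_format, of "of_real t"] elim by simp
    qed (use elim in auto)
    also have "\<dots> = norm \<kappa> * (t ^ m * exp (X t))" by (simp add: X_def exp_add mult_ac)
    also have "\<dots> + norm a \<le> norm \<kappa> * (t ^ m * exp (X t)) + norm a * (t ^ m * exp (X t))"
    proof -
      have "1 * 1 \<le> t ^ m * exp (X t)" using elim X by (intro mult_mono) auto
      from mult_left_mono[OF this norm_ge_zero[of a]] show ?thesis by simp
    qed
    also have "\<dots> = (norm a + norm \<kappa>) * (t ^ m * exp (X t))" by (simp add: algebra_simps)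
    finally have "ln (F t) \<le> ln ((norm a + norm \<kappa>) * (t ^ m * exp (X t)))"
      using elim by (intro ln_mono) auto
    also have "\<dots> = c0 + real m * ln t + X t"
      using elim \<kappa> by (simp add: c0_def ln_mult ln_realpow add_nonneg_pos less_imp_neq[symmetric] add_pos_nonneg)
    finally show ?case .
  qed
  have ln_le: "ln t \<le> t powr s / s" if "t \<ge> 1" for t
    using that s by (intro ln_powr_bound) auto
  \<comment> \<open>If d <= s, every term of the upper bound would be O(t^s), and the order of f
    could not exceed \<open>s\<close>.\<close>
  have ds: "s < real d"
  proof (rule ccontr)
    assume "\<not> s < real d"
    then have ds: "real d \<le> s" by simp
    define W' where "W' = \<bar>c0\<bar> + real m / s + (norm b + W + C) + 1"
    have W': "W' > 0" using W(1) C s by (simp add: W'_def add_nonneg_pos)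
    have "eventually (\<lambda>t. ln (F t) \<le> W' * t powr s) at_top"
      using upper eventually_ge_at_top[of 1]
    proof eventually_elim
      case (elim t)
      have 1: "1 \<le> t powr s" using elim s by (intro ge_one_powr_ge_zero) auto
      have "t ^ d = t powr real d" using elim by (subst powr_realpow) auto
      also have "\<dots> \<le> t powr s" using elim ds by (intro powr_mono) auto
      finally have 2: "t ^ d \<le> t powr s" .
      have 3: "t ^ (d - 1) \<le> t powr s"
        using power_increasing[of "d - 1" d t] elim 2 by simp
      have "c0 \<le> \<bar>c0\<bar> * 1" by simp
      also have "\<dots> \<le> \<bar>c0\<bar> * t powr s" using 1 by (intro mult_left_mono) auto
      finally have 4: "c0 \<le> \<bar>c0\<bar> * t powr s" .
      have 5: "real m * ln t \<le> real m * (t powr s / s)"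
        using ln_le[of t] elim by (intro mult_left_mono) auto
      have 6: "X t \<le> norm b * t powr s + W * t powr s + C * t powr s"
        unfolding X_def using 2 3 W(1) C by (intro add_mono mult_left_mono) auto
      have "ln (F t) \<le> \<bar>c0\<bar> * t powr s + real m * (t powr s / s) + (norm b * t powr s + W * t powr s + C * t powr s) + t powr s"
        using elim 1 4 5 6 by linarith
      also have "\<dots> = W' * t powr s" by (simp add: W'_def algebra_simps)
      finally show ?case .
    qed
    from growth_order_le[OF f W' this[unfolded F_def]] s(2) show False by simp
  qed
  then have d: "d > 0" using s by (intro gr0I) auto
  have b: "norm b > 0"
    using d by (auto simp: b_def d_def)
  have e1: "((\<lambda>t. t powr s / t ^ d) \<longlongrightarrow> 0) at_top"
  proof (rule Lim_transform_eventually)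
    show "((\<lambda>t. t powr (s - real d)) \<longlongrightarrow> 0) at_top"
      using ds by (intro tendsto_neg_powr filterlim_ident) auto
    show "eventually (\<lambda>t. t powr (s - real d) = t powr s / t ^ d) at_top"
      using eventually_gt_at_top[of 0] by eventually_elim (simp add: powr_diff powr_realpow)
  qed
  have e2: "((\<lambda>t::real. t ^ (d - 1) / t ^ d) \<longlongrightarrow> 0) at_top"
  proof (rule Lim_transform_eventually)
    show "((\<lambda>t::real. inverse t) \<longlongrightarrow> 0) at_top" by (rule tendsto_inverse_0_at_top[OF filterlim_ident])
    show "eventually (\<lambda>t::real. inverse t = t ^ (d - 1) / t ^ d) at_top"
      using eventually_gt_at_top[of 0] by eventually_elim (use d in \<open>cases d; simp add: field_simps\<close>)
  qed
  have e3: "((\<lambda>t::real. ln t / t ^ d) \<longlongrightarrow> 0) at_top"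
  proof (rule Lim_null_comparison)
    show "eventually (\<lambda>t. norm (ln t / t ^ d) \<le> 1 / s * (t powr s / t ^ d)) at_top"
      using eventually_ge_at_top[of 1]
    proof eventually_elim
      case (elim t)
      have "norm (ln t / t ^ d) = ln t / t ^ d" using elim by simp
      also have "\<dots> \<le> t powr s / s / t ^ d"
        using ln_le[OF elim] elim by (intro divide_right_mono) auto
      finally show ?case by simp
    qed
    show "((\<lambda>t. 1 / s * (t powr s / t ^ d)) \<longlongrightarrow> 0) at_top"
      by (rule tendsto_mult_right_zero[OF e1])
  qed
  have e4: "((\<lambda>t::real. 1 / t ^ d) \<longlongrightarrow> 0) at_top"
    using d by (intro tendsto_divide_0[OF tendsto_const] filterlim_at_top_imp_at_infinity filterlim_pow_at_top filterlim_ident)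
  have e5: "((\<lambda>t::real. t ^ d / t ^ d) \<longlongrightarrow> 1) at_top"
    by (rule tendsto_eventually) (use eventually_gt_at_top[of 0] in eventually_elim, simp)
  have "((\<lambda>t. ln (F t) / t ^ d) \<longlongrightarrow> norm b) at_top"
  proof (rule order_tendstoI)
    fix y assume y: "y > norm b"
    have "((\<lambda>t. c0 * (1 / t ^ d) + real m * (ln t / t ^ d) + (norm b * (t ^ d / t ^ d) + W * (t ^ (d - 1) / t ^ d) + C * (t powr s / t ^ d)))
        \<longlongrightarrow> c0 * 0 + real m * 0 + (norm b * 1 + W * 0 + C * 0)) at_top"
      by (intro tendsto_add tendsto_mult tendsto_const e1 e2 e3 e4 e5)
    then have "eventually (\<lambda>t. c0 * (1 / t ^ d) + real m * (ln t / t ^ d) + (norm b * (t ^ d / t ^ d) + W * (t ^ (d - 1) / t ^ d) + C * (t powr s / t ^ d)) < y) at_top"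
      by (rule order_tendstoD) (use y in simp)
    then show "eventually (\<lambda>t. ln (F t) / t ^ d < y) at_top"
      using upper eventually_gt_at_top[of 0]
    proof eventually_elim
      case (elim t)
      have "ln (F t) / t ^ d \<le> (c0 + real m * ln t + X t) / t ^ d"
        using elim by (intro divide_right_mono) auto
      then show ?case using elim(1,3) by (simp add: X_def add_divide_distrib)
    qed
  next
    fix y assume "y < norm b"
    \<comment> \<open>The gap between \<open>y'\<close> and |b| pays for the width of the arc, the
      gap between \<open>y\<close> and \<open>y'\<close> for all terms of size o(t^d).\<close>
    then obtain y' where y': "y < y'" "y' < norm b" using dense by blast
    \<comment> \<open>A direction in which b z^d is positive: \<open>u ^ d\<close> cancels the
      argument of \<open>b\<close>.\<close>
    define u where "u = cis (- Arg b / real d)"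
    have bu: "b * u ^ d = of_real (norm b)"
    proof -
      have "real d * (- Arg b / real d) = - Arg b" using d by simp
      then have "u ^ d = cis (- Arg b)" unfolding u_def Complex.DeMoivre by (simp only:)
      then have "b * u ^ d = of_real (norm b) * (cis (Arg b) * cis (- Arg b))"
        using b by (simp add: cis_Arg sgn_div_norm scaleR_conv_of_real field_simps)
      then show ?thesis by (simp add: cis_mult)
    qed
    have "((\<lambda>\<theta>. norm b * cos (real d * \<theta>)) \<longlongrightarrow> norm b * cos (real d * 0)) (at 0)"
      by (intro tendsto_intros)
    then have "eventually (\<lambda>\<theta>. norm b * cos (real d * \<theta>) > y') (at 0)"
      by (rule order_tendstoD) (use y' in simp)
    then obtain \<delta> where \<delta>: "\<delta> > 0" "\<And>\<theta>. \<theta> \<noteq> 0 \<Longrightarrow> \<bar>\<theta>\<bar> < \<delta> \<Longrightarrow> norm b * cos (real d * \<theta>) > y'"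
      by (auto simp: eventually_at)
    \<comment> \<open>The arc of angle 2 pi / n must fit into the \<open>\<delta>\<close>-range
      where the leading term stays above \<open>y'\<close>. As \<open>n\<close> does not depend on
      t, the loss n C t^s is still o(t^d).\<close>
    obtain n :: nat where n: "real n > 2 * pi / \<delta>" using reals_Archimedean2 by blast
    have "2 * pi / \<delta> > 0" using \<delta> by simp
    then have n0: "n > 0" using n by (intro gr0I) auto
    have n\<delta>: "2 * pi / real n < \<delta>" using n n0 \<delta> by (simp add: field_simps)
    define c1 where "c1 = norm \<kappa> * (norm (G 0) ^ n / 2)"
    have c1: "c1 > 0" using \<kappa> G(2) by (simp add: c1_def)
    define Y where "Y = (\<lambda>t. y' * t ^ d - W * t ^ (d - 1) - real n * C * t powr s)"
    have lower: "eventually (\<lambda>t. ln (F t) \<ge> ln c1 - ln (1 + norm a) + Y t) at_top"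
      using F_large eventually_ge_at_top[of 1]
    proof eventually_elim
      case (elim t)
      have "\<exists>\<theta>\<in>{0..2 * pi / real n}. norm (G (of_real t * u * cis \<theta>)) \<ge> norm (G 0) ^ n * exp (- (real n * (C * t powr s))) / 2"
      proof (rule entire_lower_bound_on_arc[OF G(1,2)])
        show "norm (G z) \<le> exp (C * t powr s)" if "norm z = t" for z
          using G(3)[rule_format, of z] that by simp
      qed (use elim n0 C in \<open>auto simp: u_def\<close>)
      then obtain \<theta> where \<theta>: "0 \<le> \<theta>" "\<theta> \<le> 2 * pi / real n"
        "norm (G (of_real t * u * cis \<theta>)) \<ge> norm (G 0) ^ n * exp (- (real n * (C * t powr s))) / 2"
        by auto
      define z where "z = of_real t * u * cis \<theta>"
      have nz: "norm z = t" using elim by (simp add: z_def u_def norm_mult)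
      define \<psi> where "\<psi> = real d * \<theta>"
      have "b * z ^ d = of_real (t ^ d) * (b * u ^ d) * cis \<psi>"
        unfolding z_def \<psi>_def power_mult_distrib Complex.DeMoivre of_real_power by (simp only: mult_ac)
      then have "Re (b * z ^ d) = t ^ d * (norm b * cos \<psi>)"
        by (simp add: bu)
      moreover have "norm b * cos \<psi> \<ge> y'"
        using \<delta>(2)[of \<theta>] \<theta> n\<delta> y' unfolding \<psi>_def by (cases "\<theta> = 0") auto
      ultimately have "Re (b * z ^ d) \<ge> y' * t ^ d"
        using elim mult_left_mono[of y' "norm b * cos \<psi>" "t ^ d"] by (simp add: mult.commute)
      then have ReQ: "Re (poly Q z) \<ge> y' * t ^ d - W * t ^ (d - 1)"
        using Re_Q[of z] nz elim by simp
      have "c1 * exp (Y t) = norm \<kappa> * 1 * (exp (y' * t ^ d - W * t ^ (d - 1)) * (norm (G 0) ^ n * exp (- (real n * (C * t powr s))) / 2))"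
        by (simp add: c1_def Y_def exp_diff exp_minus exp_add field_simps)
      also have "\<dots> \<le> norm \<kappa> * t ^ m * (exp (Re (poly Q z)) * norm (G z))"
        using elim ReQ \<theta>(3) by (intro mult_mono) (auto simp: z_def)
      also have "\<dots> = norm (eval_complex f z - a)"
        by (simp add: fact[rule_format] norm_mult norm_power nz)
      also have "\<dots> \<le> F t + norm a"
        using norm_triangle_ineq4[of "eval_complex f z" a] F_ge[of z] nz by simp
      \<comment> \<open>Since \<open>F t\<close> >= 1, the shift by \<open>a\<close> costs only the
        additive constant ln (1 + |a|) after taking logarithms.\<close>
      also have "\<dots> \<le> F t * (1 + norm a)"
        using elim mult_right_mono[of 1 "F t" "norm a"] by (simp add: algebra_simps)
      finally have "ln (c1 * exp (Y t)) \<le> ln (F t * (1 + norm a))"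
        using c1 by (intro ln_mono) auto
      moreover have "1 + norm a > 0" by (simp add: add_pos_nonneg)
      ultimately show ?case using c1 elim by (simp add: ln_mult)
    qed
    have "((\<lambda>t. (ln c1 - ln (1 + norm a)) * (1 / t ^ d) + (y' * (t ^ d / t ^ d) - W * (t ^ (d - 1) / t ^ d) - real n * C * (t powr s / t ^ d)))
        \<longlongrightarrow> (ln c1 - ln (1 + norm a)) * 0 + (y' * 1 - W * 0 - real n * C * 0)) at_top"
      by (intro tendsto_add tendsto_diff tendsto_mult tendsto_const e1 e2 e4 e5)
    then have "eventually (\<lambda>t. (ln c1 - ln (1 + norm a)) * (1 / t ^ d) + (y' * (t ^ d / t ^ d) - W * (t ^ (d - 1) / t ^ d) - real n * C * (t powr s / t ^ d)) > y) at_top"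
      by (rule order_tendstoD) (use y' in simp)
    then show "eventually (\<lambda>t. ln (F t) / t ^ d > y) at_top"
      using lower eventually_gt_at_top[of 0]
    proof eventually_elim
      case (elim t)
      have "ln (F t) / t ^ d \<ge> (ln c1 - ln (1 + norm a) + Y t) / t ^ d"
        using elim by (intro divide_right_mono) auto
      then show ?case using elim(1,3) by (simp add: Y_def add_divide_distrib diff_divide_distrib)
    qed
  qed
  then show ?thesis by (rule that[OF d b, folded F_def])
qed

theorem theorem5p10:
  fixes f :: "real fps"
  assumes "f \<in> class_K" and "entire_fps f"
    and "growth_order f < \<infinity>"
    and "\<exists>a. borel_exceptional f a"
  shows "clan f"
proof -
  from assms(4) obtain a where "borel_exceptional f a" by blast
  from borel_exceptional_regular_growth[OF assms(1-3) this]
  obtain d c where "d > 0" "c > 0" "((\<lambda>t. ln (eval_fps f t) / t ^ d) \<longlongrightarrow> c) at_top" .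
  then show ?thesis by (rule clan_if_regular_growth[OF assms(1,2)])
qed

end
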